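(* Let $f:\mathbb R^n\to\mathbb R$ and $h:\mathbb R^n\to\mathbb R^m$ be twice continuously differentiable. Assume there exist $\beta,\varrho>0$ such that, with $\mathfrak M_\beta:=\{y\in\mathbb R^n:\|h(y)\|\le\beta\}$: (i) a point $y_0\in\mathfrak M_\beta$ is known; (ii) $f,\nabla f,\nabla^2f$ and $\nabla h_i,\nabla^2h_i$ for $i=1,\dots,m$ are uniformly bounded and Lipschitz continuous on $\mathfrak M_\beta$; (iii) $\varrho$-LICQ holds at all $y\in\mathfrak M_\beta$. Let $L_f:=\max_{y\in\mathfrak M_\beta}\|\nabla f(y)\|$ and $R_\lambda:=2+2\varrho^{-1}L_f$. Let $\varepsilon_0,\varepsilon_1,\varepsilon_2>0$ and $\gamma\ge0$ satisfy $$\varepsilon_0\le\beta,\qquad\varepsilon_1\le1,\qquad\varepsilon_1^2\le\tfrac1{16}R_\lambda^{-1}\varepsilon_0\varepsilon_2,\qquad\gamma^2\le\tfrac1{16}R_\lambda^{-3}\varepsilon_0\varepsilon_2 .$$ Then there is an algorithm that, when initialized at $y_0$, requires $$O\big(\max\{\varepsilon_0^{-2}\varepsilon_1^{-2},\ \varepsilon_0^{-3}\varepsilon_2^{-3}\}\big)$$ evaluations of $f,h$ and their derivatives to produce an $(\boldsymbol\varepsilon,\gamma)$-AFAC pair $(y,\lambda)$, $\boldsymbol\varepsilon=(\varepsilon_0,\varepsilon_1,\varepsilon_2)$, for the problem $\min f(y)$ s.t. $h(y)=0$, with $\|\lambda\|\le R_\lambda$.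
   Context: The Lagrangian is $L(y,\lambda)=f(y)+\lambda\cdot h(y)$, $\lambda\in\mathbb R^m$, and $\nabla h(y)$ is the $m\times n$ Jacobian. For $\varrho>0$, $\varrho$-LICQ holds at $y$ if the smallest singular value of $\nabla h(y)$ is at least $\varrho$ (so $\nabla h(y)$ has rank $m$ and $\|\nabla h(y)^T\lambda\|\ge\varrho\|\lambda\|$ for all $\lambda$). A pair $(y,\lambda)$ is $(\boldsymbol\varepsilon,\gamma)$-AFAC (approximately feasible approximately 2-critical) if $\|h(y)\|\le\varepsilon_0$, $\|\nabla_yL(y,\lambda)\|\le\varepsilon_1$, and $u^T\nabla^2_{yy}L(y,\lambda)u\ge-\varepsilon_2$ for all unit vectors $u\in\mathbb R^n$ with $\|\nabla h(y)u\|\le\gamma$. The constant in $O(\cdot)$ may depend on the problem data ($\beta$, $\varrho$, and the bounds and Lipschitz constants in (ii)) but not on $\varepsilon_0,\varepsilon_1,\varepsilon_2,\gamma$. *)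

theory Defs
  imports "HOL-Analysis.Analysis"
begin

subsection \<open>Gradients, Hessians and smoothness\<close>

definition grad :: "(real^'n \<Rightarrow> real) \<Rightarrow> real^'n \<Rightarrow> real^'n" where
  "grad f y = (THE g. GDERIV f y :> g)"

definition hess :: "(real^'n \<Rightarrow> real) \<Rightarrow> real^'n \<Rightarrow> real^'n^'n" where
  "hess f y = jacobian (grad f) (at y)"

definition C2 :: "(real^'n \<Rightarrow> real) \<Rightarrow> bool" where
  "C2 f \<longleftrightarrow> f differentiable_on UNIV \<and> grad f differentiable_on UNIV \<and>
    continuous_on UNIV (hess f)"

abbreviation coord :: "(real^'n \<Rightarrow> real^'m) \<Rightarrow> 'm \<Rightarrow> real^'n \<Rightarrow> real" where
  "coord h i \<equiv> (\<lambda>y. h y $ i)"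

text \<open>The norm that HOL-Analysis puts on \<open>real^'n^'m\<close> is the Frobenius norm; matrices are
  measured here in the spectral norm instead.\<close>

definition spectral_norm :: "real^'n^'m \<Rightarrow> real" where
  "spectral_norm A = onorm ((*v) A)"

definition bdd_lipschitz_fun :: "real \<Rightarrow> 'a set \<Rightarrow> ('a::metric_space \<Rightarrow> 'b::real_normed_vector) \<Rightarrow> bool" where
  "bdd_lipschitz_fun K M F \<longleftrightarrow> (\<forall>y\<in>M. norm (F y) \<le> K) \<and> K-lipschitz_on M F"

definition bdd_lipschitz_mat :: "real \<Rightarrow> 'a set \<Rightarrow> ('a::metric_space \<Rightarrow> real^'n^'m) \<Rightarrow> bool" where
  "bdd_lipschitz_mat K M F \<longleftrightarrow> (\<forall>y\<in>M. spectral_norm (F y) \<le> K) \<and>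
    (\<forall>y\<in>M. \<forall>z\<in>M. spectral_norm (F y - F z) \<le> K * dist y z)"


subsection \<open>The constrained problem\<close>

definition near_feasible :: "(real^'n \<Rightarrow> real^'m) \<Rightarrow> real \<Rightarrow> (real^'n) set" where
  "near_feasible h \<beta> = {y. norm (h y) \<le> \<beta>}"

definition lagrangian :: "(real^'n \<Rightarrow> real) \<Rightarrow> (real^'n \<Rightarrow> real^'m) \<Rightarrow> real^'n \<Rightarrow> real^'m \<Rightarrow> real" where
  "lagrangian f h y lam = f y + lam \<bullet> h y"

text \<open>An \<open>m \<times> n\<close> matrix \<open>A\<close> is given \<open>m\<close> singular values, the square roots of the eigenvalues of
  \<open>A A\<^sup>T\<close>. With this convention a positive smallest singular value means that \<open>A\<close> has rank \<open>m\<close>,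
  so in particular \<open>m \<le> n\<close>.\<close>

definition singular_values :: "real^'n^'m \<Rightarrow> real set" where
  "singular_values A = {sqrt \<mu> | \<mu>. \<exists>v. v \<noteq> 0 \<and> (A ** transpose A) *v v = \<mu> *\<^sub>R v}"

definition LICQ :: "real \<Rightarrow> (real^'n \<Rightarrow> real^'m) \<Rightarrow> real^'n \<Rightarrow> bool" where
  "LICQ \<rho> h y \<longleftrightarrow> \<rho> \<le> Min (singular_values (jacobian h (at y)))"

definition AFAC :: "real \<Rightarrow> real \<Rightarrow> real \<Rightarrow> real \<Rightarrow> (real^'n \<Rightarrow> real) \<Rightarrow> (real^'n \<Rightarrow> real^'m) \<Rightarrow>
    real^'n \<Rightarrow> real^'m \<Rightarrow> bool" where
  "AFAC \<epsilon>0 \<epsilon>1 \<epsilon>2 \<gamma> f h y lam \<longleftrightarrow>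
    norm (h y) \<le> \<epsilon>0 \<and>
    norm (grad (\<lambda>z. lagrangian f h z lam) y) \<le> \<epsilon>1 \<and>
    (\<forall>u. norm u = 1 \<longrightarrow> norm (jacobian h (at y) *v u) \<le> \<gamma> \<longrightarrow>
      u \<bullet> (hess (\<lambda>z. lagrangian f h z lam) y *v u) \<ge> - \<epsilon>2)"

text \<open>One common constant \<open>K\<close> serves as bound and as Lipschitz constant for all functions
  in the regularity assumption; different constants are covered by taking their maximum.\<close>

definition regular_problem :: "real \<Rightarrow> real \<Rightarrow> real \<Rightarrow> (real^'n \<Rightarrow> real) \<Rightarrow> (real^'n \<Rightarrow> real^'m) \<Rightarrow> bool" where
  "regular_problem \<beta> \<rho> K f h \<longleftrightarrow>
    C2 f \<and> (\<forall>i. C2 (coord h i)) \<and>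
    bdd_lipschitz_fun K (near_feasible h \<beta>) f \<and>
    bdd_lipschitz_fun K (near_feasible h \<beta>) (grad f) \<and>
    bdd_lipschitz_mat K (near_feasible h \<beta>) (hess f) \<and>
    (\<forall>i. bdd_lipschitz_fun K (near_feasible h \<beta>) (grad (coord h i))) \<and>
    (\<forall>i. bdd_lipschitz_mat K (near_feasible h \<beta>) (hess (coord h i))) \<and>
    (\<forall>y\<in>near_feasible h \<beta>. LICQ \<rho> h y)"


subsection \<open>Oracle algorithms\<close>

text \<open>A deterministic algorithm is a decision tree: it either stops with a result, or asks
  the oracle about a point and continues depending on the answer. It has no other access to the
  problem functions. Only the number of oracle calls is charged; the arithmetic between two calls
  is exact and free.\<close>

datatype ('q, 'a, 'r) oracle_alg =
    Return 'r
  | Query 'q "'a \<Rightarrow> ('q, 'a, 'r) oracle_alg"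

primrec result :: "('q \<Rightarrow> 'a) \<Rightarrow> ('q, 'a, 'r) oracle_alg \<Rightarrow> 'r" where
  "result orc (Return r) = r"
| "result orc (Query q k) = result orc (k (orc q))"

primrec evaluations :: "('q \<Rightarrow> 'a) \<Rightarrow> ('q, 'a, 'r) oracle_alg \<Rightarrow> nat" where
  "evaluations orc (Return r) = 0"
| "evaluations orc (Query q k) = Suc (evaluations orc (k (orc q)))"

text \<open>One evaluation returns, at the queried point, the values of \<open>f\<close> and \<open>h\<close> and their
  derivatives up to order two.\<close>

type_synonym ('n, 'm) jet =
  "real \<times> (real^'n) \<times> (real^'n^'n) \<times> (real^'m) \<times> (real^'n^'m) \<times> (real^'n^'n^'m)"

type_synonym ('n, 'm) opt_alg = "(real^'n, ('n, 'm) jet, (real^'n) \<times> (real^'m)) oracle_alg"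

definition jet_oracle :: "(real^'n \<Rightarrow> real) \<Rightarrow> (real^'n \<Rightarrow> real^'m) \<Rightarrow> real^'n \<Rightarrow> ('n, 'm) jet" where
  "jet_oracle f h y =
    (f y, grad f y, hess f y, h y, jacobian h (at y), (\<chi> i. hess (coord h i) y))"

end

theory Submission
  imports Defs
begin

text \<open>The algorithm minimises the quadratic penalty \<open>\<Phi> = f + \<sigma>/2 \<parallel>h\<parallel>\<^sup>2\<close> with \<open>\<sigma> = 2R/\<epsilon>\<^sub>0\<close>, using
  gradient steps of length \<open>\<parallel>\<nabla>\<Phi>\<parallel>/L\<close> and negative curvature steps of length \<open>\<epsilon>\<^sub>2/L\<close>, where
  \<open>L = c/\<epsilon>\<^sub>0\<close> bounds the second derivative of \<open>\<Phi>\<close> and its Lipschitz constant. At a point with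
  multiplier \<open>\<lambda> = \<sigma> h(y)\<close> one has \<open>\<nabla>\<Phi>(y) = \<nabla>\<^sub>yL(y,\<lambda>)\<close> and
  \<open>\<nabla>\<^sup>2\<Phi>(y) = \<nabla>\<^sup>2\<^sub>y\<^sub>yL(y,\<lambda>) + \<sigma> \<nabla>h(y)\<^sup>T \<nabla>h(y)\<close>, so approximate second order points of \<open>\<Phi>\<close> are approximately
  2-critical; LICQ turns a small \<open>\<nabla>\<Phi>\<close> into a bound on \<open>\<parallel>\<lambda>\<parallel>\<close>, and \<open>h(y) = \<lambda>/\<sigma>\<close> is then small. The
  steps decrease \<open>\<Phi>\<close> by multiples of \<open>\<epsilon>\<^sub>0 \<epsilon>\<^sub>1\<^sup>2\<close> and \<open>\<epsilon>\<^sub>0\<^sup>2 \<epsilon>\<^sub>2\<^sup>3\<close>, while the oscillation of \<open>\<Phi>\<close> is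
  of order \<open>1/\<epsilon>\<^sub>0\<close>. The iterates remain in the region where the regularity assumptions hold:
  where \<open>\<parallel>h\<parallel> \<ge> \<beta>/2\<close> the penalty term dominates \<open>\<nabla>f\<close>, so a gradient step decreases \<open>\<parallel>h\<parallel>\<close>, and
  elsewhere the steps are too short to leave.\<close>

subsection \<open>The smallest singular value\<close>

text \<open>Eigenvectors of the symmetric matrix \<open>A ** transpose A\<close> for distinct
  eigenvalues are orthogonal, hence independent, so there are only finitely many eigenvalues.
  Finiteness is what gives \<open>Min\<close> in \<open>LICQ\<close> its meaning.\<close>

lemma finite_singular_values:
  fixes A :: "real^'n^'m"
  shows "finite (singular_values A)"
proof -
  let ?B = "A ** transpose A"
  define E where "E = {\<mu>. \<exists>v. v \<noteq> 0 \<and> ?B *v v = \<mu> *\<^sub>R v}"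
  have "\<forall>\<mu>\<in>E. \<exists>v. v \<noteq> 0 \<and> ?B *v v = \<mu> *\<^sub>R v"
    by (simp add: E_def)
  then obtain e where e: "\<forall>\<mu>\<in>E. e \<mu> \<noteq> 0 \<and> ?B *v e \<mu> = \<mu> *\<^sub>R e \<mu>"
    by (rule bchoice[THEN exE])
  have sym: "(?B *v x) \<bullet> y = x \<bullet> (?B *v y)" for x y
    using dot_lmul_matrix[of y A "transpose A *v x"] dot_lmul_matrix[of x A "transpose A *v y"]
    by (simp add: inner_commute flip: matrix_vector_mul_assoc)
  have orth: "orthogonal (e a) (e b)" if "a \<in> E" "b \<in> E" "a \<noteq> b" for a b
    using sym[of "e a" "e b"] e that by (simp add: orthogonal_def)
  have inj: "inj_on e E"
    using orth e by (metis inj_onI orthogonal_self)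
  have "pairwise orthogonal (e ` E)"
    using orth by (auto simp: pairwise_def)
  then have "independent (e ` E)"
    using e by (intro pairwise_orthogonal_independent) auto
  then have "finite E"
    using inj finite_imageD independent_imp_finite by blast
  moreover have "singular_values A = sqrt ` E"
    unfolding singular_values_def E_def by auto
  ultimately show ?thesis by simp
qed

lemma norm_add_scaleR_power2:
  fixes a b :: "'a::real_inner"
  shows "(norm (a + t *\<^sub>R b))\<^sup>2 = (norm a)\<^sup>2 + 2 * t * (a \<bullet> b) + t\<^sup>2 * (norm b)\<^sup>2"
  unfolding power2_norm_eq_inner
  by (simp add: inner_add_left inner_add_right inner_commute power2_eq_square)

text \<open>A minimiser of \<open>\<parallel>A\<^sup>T v\<parallel>\<close> over the unit sphere is an eigenvector of \<open>A A\<^sup>T\<close>, because the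
  quadratic form \<open>\<parallel>A\<^sup>T v\<parallel>\<^sup>2 - \<mu> \<parallel>v\<parallel>\<^sup>2\<close> is nonnegative and vanishes there.\<close>

lemma Min_singular_values_le:
  fixes A :: "real^'n^'m"
  shows "Min (singular_values A) * norm v \<le> norm (transpose A *v v)"
proof -
  let ?T = "\<lambda>v. transpose A *v v"
  have lin: "linear ?T" by (rule matrix_vector_mul_linear)
  have "\<exists>e\<in>sphere (0::real^'m) 1. \<forall>v\<in>sphere 0 1. norm (?T e) \<le> norm (?T v)"
    using lin by (intro continuous_attains_inf continuous_on_norm linear_continuous_on)
      (auto simp: linear_conv_bounded_linear)
  then obtain e :: "real^'m" where e: "norm e = 1"
    and min: "\<And>v. norm v = 1 \<Longrightarrow> norm (?T e) \<le> norm (?T v)"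
    by (auto simp del: transpose_matrix_vector)
  define \<mu> where "\<mu> = (norm (?T e))\<^sup>2"
  define q where "q = (\<lambda>v. (norm (?T v))\<^sup>2 - \<mu> * (norm v)\<^sup>2)"
  have scale: "norm (?T e) * norm v \<le> norm (?T v)" for v
  proof (cases "v = 0")
    case False
    have "norm (?T e) \<le> norm (?T ((1 / norm v) *\<^sub>R v))"
      using False by (intro min) simp
    also have "\<dots> = norm (?T v) / norm v"
      by (simp add: linear_scale[OF lin] del: transpose_matrix_vector)
    finally show ?thesis
      using False by (simp add: field_simps del: transpose_matrix_vector)
  qed simp
  have q0: "0 \<le> q v" for v
    using power_mono[OF scale[of v], of 2]
    by (simp add: q_def \<mu>_def power_mult_distrib del: transpose_matrix_vector)
  let ?c = "\<lambda>w. (?T e) \<bullet> (?T w) - \<mu> * (e \<bullet> w)"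
  have qe: "q (e + t *\<^sub>R w) = 2 * t * ?c w + t\<^sup>2 * q w" for t w
    by (simp add: q_def \<mu>_def e linear_add[OF lin] linear_scale[OF lin] norm_add_scaleR_power2
        algebra_simps del: transpose_matrix_vector)
  have c0: "?c w = 0" for w
  proof (rule ccontr)
    assume c: "?c w \<noteq> 0"
    \<comment> \<open>The minimiser of the parabola in \<open>t\<close> would be
      \<open>- ?c w / q w\<close>. Adding 1 keeps the denominator positive when
      \<open>q w = 0\<close>, and the value at \<open>t\<close> is still negative.\<close>
    define t where "t = - ?c w / (q w + 1)"
    have "0 \<le> 2 * t * ?c w + t\<^sup>2 * q w"
      using q0[of "e + t *\<^sub>R w"] qe by simp
    also have "\<dots> = - (?c w)\<^sup>2 * (q w + 2) / (q w + 1)\<^sup>2"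
      using q0[of w] unfolding t_def by (simp add: divide_simps power2_eq_square) algebra
    also have "\<dots> < 0"
      using q0[of w] c by (intro divide_neg_pos mult_neg_pos) auto
    finally show False by simp
  qed
  have "((A ** transpose A) *v e - \<mu> *\<^sub>R e) \<bullet> w = 0" for w
    using c0[of w] dot_lmul_matrix[of w A "?T e"]
    by (simp add: inner_diff_left inner_diff_right inner_commute flip: matrix_vector_mul_assoc)
  from this[of "(A ** transpose A) *v e - \<mu> *\<^sub>R e"]
  have "(A ** transpose A) *v e = \<mu> *\<^sub>R e"
    unfolding inner_eq_zero_iff by (rule eq_iff_diff_eq_0[THEN iffD2])
  then have "sqrt \<mu> \<in> singular_values A"
    unfolding singular_values_def using e by (intro CollectI exI[of _ \<mu>] conjI exI[of _ e]) auto
  then have "Min (singular_values A) \<le> norm (?T e)"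
    using finite_singular_values by (auto simp: \<mu>_def intro!: Min_le)
  then show ?thesis
    using scale[of v] mult_right_mono[of _ _ "norm v"] norm_ge_zero order_trans by blast
qed


subsection \<open>Gradients, Jacobians and Hessians\<close>

lemma GDERIV_unique:
  assumes "GDERIV f y :> a" "GDERIV f y :> b"
  shows "a = b"
proof -
  have "(\<lambda>u. u \<bullet> a) = (\<lambda>u. u \<bullet> b)"
    using assms unfolding gderiv_def by (rule has_derivative_unique)
  then have "\<forall>u. u \<bullet> a = u \<bullet> b" by (simp add: fun_eq_iff)
  then show ?thesis by (simp add: vector_eq_ldot)
qed

lemma grad_eqI:
  assumes "GDERIV f y :> g"
  shows "grad f y = g"
  unfolding grad_def using assms by (rule the_equality) (rule GDERIV_unique[OF _ assms])

text \<open>The derivative is a linear functional, represented by the value of its adjoint at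
  1.\<close>

lemma GDERIV_grad:
  assumes "f differentiable at y"
  shows "GDERIV f y :> grad f y"
proof -
  obtain f' where f': "(f has_derivative f') (at y)"
    using assms by (auto simp: differentiable_def)
  then have lin: "linear f'" by (rule has_derivative_linear)
  have "f' = (\<lambda>u. u \<bullet> adjoint f' 1)"
    using adjoint_works[OF lin, of _ 1] by auto
  then have "GDERIV f y :> adjoint f' 1"
    using f' unfolding gderiv_def by simp
  then show ?thesis by (simp add: grad_eqI)
qed

lemma C2_GDERIV: "C2 f \<Longrightarrow> GDERIV f y :> grad f y"
  by (auto simp: C2_def differentiable_on_def intro: GDERIV_grad)

lemma C2_hess: "C2 f \<Longrightarrow> (grad f has_derivative (\<lambda>u. hess f y *v u)) (at y)"
  by (auto simp: C2_def differentiable_on_def hess_def simp flip: jacobian_works)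

lemma has_derivative_matrix_unique:
  assumes "(F has_derivative (\<lambda>u. A *v u)) (at y)" "(F has_derivative (\<lambda>u. B *v u)) (at y)"
  shows "A = B"
  using has_derivative_unique[OF assms] by (metis matrix_eq)

text \<open>The matrix with rows \<open>grad (coord h i) y\<close> represents the derivative of
  \<open>h\<close>, and uniqueness of derivatives identifies it with
  \<open>jacobian\<close>.\<close>

lemma C2_jacobian:
  fixes h :: "real^'n \<Rightarrow> real^'m"
  assumes "\<And>i. C2 (coord h i)"
  shows "(h has_derivative (\<lambda>u. jacobian h (at y) *v u)) (at y)"
    and "(jacobian h (at y) *v u) $ i = grad (coord h i) y \<bullet> u"
    and "transpose (jacobian h (at y)) *v v = (\<Sum>i\<in>UNIV. v $ i *\<^sub>R grad (coord h i) y)"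
proof -
  let ?J = "\<chi> i. grad (coord h i) y"
  have "((\<lambda>x. h x) has_derivative (\<lambda>u. ?J *v u)) (at y)"
    unfolding has_derivative_componentwise_within[of h]
  proof
    fix b :: "real^'m" assume "b \<in> Basis"
    then obtain i where b: "b = axis i 1" by (auto simp: Basis_vec_def)
    have "(coord h i has_derivative (\<lambda>u. u \<bullet> grad (coord h i) y)) (at y)"
      using C2_GDERIV[OF assms] unfolding gderiv_def .
    then show "((\<lambda>x. h x \<bullet> b) has_derivative (\<lambda>u. (?J *v u) \<bullet> b)) (at y)"
      by (simp add: b inner_axis matrix_vector_mul_component inner_commute[of "grad _ _"])
  qed
  moreover from this have "(h has_derivative (\<lambda>u. jacobian h (at y) *v u)) (at y)"
    using jacobian_works[of h "at y"] by (auto simp: differentiable_def)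
  ultimately have J: "jacobian h (at y) = ?J"
    and h: "(h has_derivative (\<lambda>u. jacobian h (at y) *v u)) (at y)"
    by (auto intro: has_derivative_matrix_unique)
  show "(h has_derivative (\<lambda>u. jacobian h (at y) *v u)) (at y)" by (rule h)
  show "(jacobian h (at y) *v u) $ i = grad (coord h i) y \<bullet> u"
    by (simp add: J matrix_vector_mul_component)
  show "transpose (jacobian h (at y)) *v v = (\<Sum>i\<in>UNIV. v $ i *\<^sub>R grad (coord h i) y)"
    unfolding J matrix_mult_sum by (simp add: column_transpose row_def vec_eq_iff scalar_mult_eq_scaleR)
qed

lemma matrix_vector_mult_sum_left: "(\<Sum>i\<in>I. A i) *v u = (\<Sum>i\<in>I. A i *v u)"
  by (induction I rule: infinite_finite_induct) (simp_all add: matrix_vector_mult_add_rdistrib)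

text \<open>For \<open>v = \<sigma> *\<^sub>R h y\<close> the right-hand sides become
  \<open>pen_grad y\<close> and \<open>lag_hess y\<close>, so \<open>AFAC\<close> can be read off
  from what the algorithm computes.\<close>

lemma lagrangian_derivs:
  assumes "C2 f" "\<And>i. C2 (coord h i)"
  shows "grad (\<lambda>z. lagrangian f h z v) y = grad f y + transpose (jacobian h (at y)) *v v"
    and "hess (\<lambda>z. lagrangian f h z v) y = hess f y + (\<Sum>i\<in>UNIV. v $ i *\<^sub>R hess (coord h i) y)"
proof -
  have g: "grad (\<lambda>z. lagrangian f h z v) y = grad f y + (\<Sum>i\<in>UNIV. v $ i *\<^sub>R grad (coord h i) y)" for y
  proof (rule grad_eqI)
    show "GDERIV (\<lambda>z. lagrangian f h z v) y :> grad f y + (\<Sum>i\<in>UNIV. v $ i *\<^sub>R grad (coord h i) y)"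
      using C2_GDERIV[OF assms(1)] C2_GDERIV[OF assms(2)]
      unfolding lagrangian_def gderiv_def inner_vec_def[of v]
      by (auto intro!: derivative_eq_intros simp: inner_add_right inner_sum_right)
  qed
  then show "grad (\<lambda>z. lagrangian f h z v) y = grad f y + transpose (jacobian h (at y)) *v v"
    by (simp add: C2_jacobian(3)[OF assms(2)] del: transpose_matrix_vector)
  have "(grad (\<lambda>z. lagrangian f h z v) has_derivative
      (\<lambda>u. (hess f y + (\<Sum>i\<in>UNIV. v $ i *\<^sub>R hess (coord h i) y)) *v u)) (at y)"
    unfolding g[abs_def]
    by (auto intro!: derivative_eq_intros C2_hess assms
        simp: matrix_vector_mult_add_rdistrib matrix_vector_mult_sum_left
          simp flip: scaleR_matrix_vector_assoc)
  from this differentiableI[OF this, unfolded jacobian_works, folded hess_def]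
  show "hess (\<lambda>z. lagrangian f h z v) y = hess f y + (\<Sum>i\<in>UNIV. v $ i *\<^sub>R hess (coord h i) y)"
    by (rule has_derivative_matrix_unique[symmetric])
qed

lemma inner_matrix_spectral_norm: "\<bar>u \<bullet> (A *v u)\<bar> \<le> spectral_norm A * (norm u)\<^sup>2"
proof -
  have "\<bar>u \<bullet> (A *v u)\<bar> \<le> norm u * (spectral_norm A * norm u)"
    unfolding spectral_norm_def
    by (rule order_trans[OF Cauchy_Schwarz_ineq2 mult_left_mono[OF onorm]]) auto
  then show ?thesis by (simp add: power2_eq_square ac_simps)
qed

text \<open>The region \<open>near_feasible h \<beta>\<close> may be nonconvex, so all estimates are
  made along single segments, by calculus in one variable.\<close>

lemma C2_line_derivs:
  fixes y d :: "real^'n"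
  assumes "C2 f"
  shows "((\<lambda>s. f (y + s *\<^sub>R d)) has_real_derivative grad f (y + s *\<^sub>R d) \<bullet> d) (at s)"
    and "((\<lambda>s. grad f (y + s *\<^sub>R d) \<bullet> d) has_real_derivative
      d \<bullet> (hess f (y + s *\<^sub>R d) *v d)) (at s)"
proof -
  have l: "((\<lambda>s. y + s *\<^sub>R d) has_derivative (\<lambda>s. s *\<^sub>R d)) (at s)"
    by (auto intro!: derivative_eq_intros)
  show "((\<lambda>s. f (y + s *\<^sub>R d)) has_real_derivative grad f (y + s *\<^sub>R d) \<bullet> d) (at s)"
    using has_derivative_compose[OF l C2_GDERIV[OF assms, unfolded gderiv_def]]
    by (simp add: has_field_derivative_def inner_commute mult.commute[of _ "_ \<bullet> _"])
  show "((\<lambda>s. grad f (y + s *\<^sub>R d) \<bullet> d) has_real_derivative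
      d \<bullet> (hess f (y + s *\<^sub>R d) *v d)) (at s)"
    using has_derivative_inner_left[OF has_derivative_compose[OF l C2_hess[OF assms]], of d]
    by (simp add: has_field_derivative_def inner_commute matrix_vector_mult_scaleR mult_commute_abs)
qed


subsection \<open>Functions on an interval\<close>

text \<open>Subtracting the primitives of the affine bound leaves a nonincreasing function, first
  for \<open>p'\<close> and then for \<open>p\<close>. With \<open>c1 = 0\<close> this yields
  quadratic descent inequalities; with \<open>c0\<close> the second derivative at 0 and
  \<open>c1\<close> its Lipschitz constant, cubic ones.\<close>

lemma taylor_le:
  fixes p p' p'' :: "real \<Rightarrow> real"
  assumes p: "\<And>s. (p has_real_derivative p' s) (at s)"
    and p': "\<And>s. (p' has_real_derivative p'' s) (at s)"
    and le: "\<And>s. 0 \<le> s \<Longrightarrow> s \<le> b \<Longrightarrow> p'' s \<le> c0 + c1 * s"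
    and b: "0 \<le> b"
  shows "p b \<le> p 0 + b * p' 0 + c0 * b\<^sup>2 / 2 + c1 * b ^ 3 / 6"
proof -
  have 1: "p' s - c0 * s - c1 * s\<^sup>2 / 2 \<le> p' 0 - c0 * 0 - c1 * 0\<^sup>2 / 2" if "0 \<le> s" "s \<le> b" for s
  proof (rule DERIV_nonpos_imp_nonincreasing[OF \<open>0 \<le> s\<close>])
    fix x assume x: "0 \<le> x" "x \<le> s"
    have "((\<lambda>s. p' s - c0 * s - c1 * s\<^sup>2 / 2) has_real_derivative (p'' x - c0 - c1 * x)) (at x)"
      by (auto intro!: derivative_eq_intros p')
    with le[of x] x that
    show "\<exists>y. ((\<lambda>s. p' s - c0 * s - c1 * s\<^sup>2 / 2) has_real_derivative y) (at x) \<and> y \<le> 0"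
      by (intro exI[of _ "p'' x - c0 - c1 * x"]) auto
  qed
  have "p b - p' 0 * b - c0 * b\<^sup>2 / 2 - c1 * b ^ 3 / 6
      \<le> p 0 - p' 0 * 0 - c0 * 0\<^sup>2 / 2 - c1 * 0 ^ 3 / 6"
  proof (rule DERIV_nonpos_imp_nonincreasing[OF b])
    fix x assume x: "0 \<le> x" "x \<le> b"
    have "((\<lambda>s. p s - p' 0 * s - c0 * s\<^sup>2 / 2 - c1 * s ^ 3 / 6) has_real_derivative
        (p' x - p' 0 - c0 * x - c1 * x\<^sup>2 / 2)) (at x)"
      by (auto intro!: derivative_eq_intros p)
    with 1[OF x]
    show "\<exists>y. ((\<lambda>s. p s - p' 0 * s - c0 * s\<^sup>2 / 2 - c1 * s ^ 3 / 6) has_real_derivative y) (at x)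
        \<and> y \<le> 0"
      by (intro exI[of _ "p' x - p' 0 - c0 * x - c1 * x\<^sup>2 / 2"]) auto
  qed
  then show ?thesis by (simp add: mult.commute)
qed

text \<open>A first exit argument: derivative bounds are available only inside the region, so
  \<open>step\<close> may use only what holds up to \<open>a\<close>. The infimum of the exceeding
  parameters is positive by \<open>start\<close>, satisfies the bound by continuity and satisfies it
  strictly by \<open>step\<close>; continuity carries this past the infimum, a contradiction.
  \<open>start\<close> is separate because \<open>p 0 = b\<close> can occur.\<close>

lemma no_exit:
  fixes p :: "real \<Rightarrow> real"
  assumes cont: "continuous_on {0..1} p" and "p 0 \<le> b"
    and start: "\<exists>e>0. \<forall>s. 0 < s \<and> s < e \<longrightarrow> p s \<le> b"
    and step: "\<And>a. 0 < a \<Longrightarrow> a < 1 \<Longrightarrow> (\<And>s. 0 \<le> s \<Longrightarrow> s \<le> a \<Longrightarrow> p s \<le> b) \<Longrightarrow> p a < b"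
    and s: "0 \<le> s" "s \<le> 1"
  shows "p s \<le> b"
proof (rule ccontr)
  assume "\<not> p s \<le> b"
  define S where "S = {r \<in> {0..1}. b < p r}"
  define a where "a = Inf S"
  have S: "s \<in> S" "bdd_below S" using \<open>\<not> p s \<le> b\<close> s unfolding S_def by (auto intro: bdd_belowI)
  obtain e where e: "e > 0" "\<And>r. 0 < r \<Longrightarrow> r < e \<Longrightarrow> p r \<le> b" using start by blast
  have eS: "e \<le> r" if "r \<in> S" for r
    using that e(2)[of r] \<open>p 0 \<le> b\<close> unfolding S_def
    by (cases "r = 0") (auto simp: not_less[symmetric])
  have a: "0 < a" "a \<le> s"
    using e(1) cInf_greatest[of S e] S eS unfolding a_def by (auto intro: cInf_lower less_le_trans)
  have before: "p r \<le> b" if "0 \<le> r" "r < a" for r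
    using that cInf_lower[OF _ S(2), of r] a s unfolding a_def S_def by force
  have pa: "p a \<le> b"
  proof (rule ccontr)
    assume "\<not> p a \<le> b"
    moreover have "continuous (at a within {0..1}) p"
      using cont a s by (auto simp: continuous_on_eq_continuous_within)
    ultimately obtain d where d: "d > 0" "\<And>x. x \<in> {0..1} \<Longrightarrow> dist x a < d \<Longrightarrow> dist (p x) (p a) < p a - b"
      unfolding continuous_within_eps_delta by (metis diff_gt_0_iff_gt not_le)
    define r where "r = max 0 (a - d / 2)"
    have "dist (p r) (p a) < p a - b"
      using d(1) a s by (intro d(2)) (auto simp: r_def dist_real_def)
    then have "b < p r" by (auto simp: dist_real_def)
    moreover have "0 \<le> r" "r < a" using d(1) a by (auto simp: r_def)
    ultimately show False using before by fastforce
  qed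
  have le: "p r \<le> b" if "0 \<le> r" "r \<le> a" for r
    using before pa that by (cases "r = a") auto
  have "a < s" using a(2) pa \<open>\<not> p s \<le> b\<close> by (cases "a = s") auto
  then have "p a < b" using step[of a] a s le by auto
  moreover have "continuous (at a within {0..1}) p"
    using cont a s by (auto simp: continuous_on_eq_continuous_within)
  ultimately obtain d where d: "d > 0" "\<And>x. x \<in> {0..1} \<Longrightarrow> dist x a < d \<Longrightarrow> dist (p x) (p a) < b - p a"
    unfolding continuous_within_eps_delta by (metis diff_gt_0_iff_gt)
  obtain r where r: "r \<in> S" "r < a + d"
    using cInf_lessD[of S "a + d"] S d(1) unfolding a_def by auto
  have "a \<le> r" using cInf_lower[OF r(1) S(2)] by (simp add: a_def)
  then have "dist (p r) (p a) < b - p a"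
    using r by (intro d(2)) (auto simp: S_def dist_real_def)
  then show False using r(1) by (auto simp: S_def dist_real_def)
qed


subsection \<open>The quadratic penalty function\<close>

lemma bdd_lipschitz_directional:
  assumes grad: "bdd_lipschitz_fun K M (grad g)" and hess: "bdd_lipschitz_mat K M (hess g)"
    and z: "z \<in> M" and w: "w \<in> M"
  shows "\<bar>grad g z \<bullet> d\<bar> \<le> K * norm d"
    and "\<bar>d \<bullet> (hess g z *v d)\<bar> \<le> K * (norm d)\<^sup>2"
    and "\<bar>grad g z \<bullet> d - grad g w \<bullet> d\<bar> \<le> K * dist z w * norm d"
    and "\<bar>d \<bullet> (hess g z *v d) - d \<bullet> (hess g w *v d)\<bar> \<le> K * dist z w * (norm d)\<^sup>2"
proof -
  have 1: "norm (grad g z) \<le> K" "norm (grad g z - grad g w) \<le> K * dist z w"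
    using grad z w unfolding bdd_lipschitz_fun_def by (auto simp: dist_norm dest: lipschitz_onD)
  have 2: "spectral_norm (hess g z) \<le> K" "spectral_norm (hess g z - hess g w) \<le> K * dist z w"
    using hess z w unfolding bdd_lipschitz_mat_def by auto
  show "\<bar>grad g z \<bullet> d\<bar> \<le> K * norm d"
    using Cauchy_Schwarz_ineq2 1(1) by (rule order_trans[OF _ mult_right_mono]) simp
  show "\<bar>grad g z \<bullet> d - grad g w \<bullet> d\<bar> \<le> K * dist z w * norm d"
    unfolding inner_diff_left[symmetric]
    using Cauchy_Schwarz_ineq2 1(2) by (rule order_trans[OF _ mult_right_mono]) simp
  show "\<bar>d \<bullet> (hess g z *v d)\<bar> \<le> K * (norm d)\<^sup>2"
    using inner_matrix_spectral_norm 2(1) by (rule order_trans[OF _ mult_right_mono]) simp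
  show "\<bar>d \<bullet> (hess g z *v d) - d \<bullet> (hess g w *v d)\<bar> \<le> K * dist z w * (norm d)\<^sup>2"
    unfolding inner_diff_right[symmetric] matrix_vector_mult_diff_rdistrib[symmetric]
    using inner_matrix_spectral_norm 2(2) by (rule order_trans[OF _ mult_right_mono]) simp
qed

text \<open>\<open>regular_problem\<close> bounds the gradients of the components of
  \<open>h\<close> but not the variation of \<open>h\<close> itself. The mean value theorem supplies
  it on segments inside \<open>M\<close>.\<close>

lemma line_lipschitz:
  fixes y d :: "real^'n"
  assumes "C2 g" and K: "\<And>z. z \<in> M \<Longrightarrow> norm (grad g z) \<le> K"
    and seg: "\<And>s. 0 \<le> s \<Longrightarrow> s \<le> b \<Longrightarrow> y + s *\<^sub>R d \<in> M" and b: "0 \<le> b"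
  shows "\<bar>g (y + b *\<^sub>R d) - g y\<bar> \<le> K * norm d * b"
proof (cases "b = 0")
  case False
  then obtain z where z: "0 < z" "z < b"
    "g (y + b *\<^sub>R d) - g (y + 0 *\<^sub>R d) = (b - 0) * (grad g (y + z *\<^sub>R d) \<bullet> d)"
    using MVT2[of 0 b "\<lambda>s. g (y + s *\<^sub>R d)" "\<lambda>s. grad g (y + s *\<^sub>R d) \<bullet> d"]
      C2_line_derivs(1)[OF \<open>C2 g\<close>] b by auto
  have "\<bar>grad g (y + z *\<^sub>R d) \<bullet> d\<bar> \<le> K * norm d"
    using Cauchy_Schwarz_ineq2 by (rule order_trans[OF _ mult_right_mono[OF K[OF seg]]]) (use z in auto)
  then have "b * \<bar>grad g (y + z *\<^sub>R d) \<bullet> d\<bar> \<le> b * (K * norm d)"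
    using b by (rule mult_left_mono)
  then show ?thesis using z(3) b by (simp add: abs_mult ac_simps)
qed simp

locale penalty =
  fixes f :: "real^'n \<Rightarrow> real" and h :: "real^'n \<Rightarrow> real^'m" and \<beta> \<rho> K \<sigma> :: real
  assumes reg: "regular_problem \<beta> \<rho> K f h" and nonempty: "near_feasible h \<beta> \<noteq> {}"
    and \<beta>: "0 < \<beta>" and \<rho>: "0 < \<rho>" and \<sigma>: "0 < \<sigma>"
begin

abbreviation "M \<equiv> near_feasible h \<beta>"

abbreviation "J y \<equiv> jacobian h (at y)"

text \<open>A common bound for the second derivative of \<open>infeas\<close> in a unit direction
  and for its Lipschitz constant on segments in \<open>M\<close>. The cardinality comes from summing
  over the components of \<open>h\<close>.\<close>

definition "B = real CARD('m) * (3 * K\<^sup>2 + \<beta> * K)"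

definition "infeas y = (norm (h y))\<^sup>2 / 2"

definition "pen y = f y + \<sigma> * infeas y"

definition "pen_grad y = grad f y + transpose (J y) *v (\<sigma> *\<^sub>R h y)"

text \<open>The multiplier is held fixed, so this is the Hessian of the Lagrangian and not that of
  \<open>pen\<close>.\<close>

definition "lag_hess y = hess f y + (\<Sum>i\<in>UNIV. (\<sigma> *\<^sub>R h y) $ i *\<^sub>R hess (coord h i) y)"

lemma C2f: "C2 f" and C2h: "C2 (coord h i)"
  using reg by (auto simp: regular_problem_def)

lemma bounds_f: "bdd_lipschitz_fun K M f" "bdd_lipschitz_fun K M (grad f)" "bdd_lipschitz_mat K M (hess f)"
  and bounds_h: "bdd_lipschitz_fun K M (grad (coord h i))" "bdd_lipschitz_mat K M (hess (coord h i))"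
  using reg by (auto simp: regular_problem_def)

lemmas directional_f = bdd_lipschitz_directional[OF bounds_f(2,3)]
lemmas directional_h = bdd_lipschitz_directional[OF bounds_h]

lemma K_nonneg: "0 \<le> K"
  using bounds_f(1) nonempty unfolding bdd_lipschitz_fun_def by (meson ex_in_conv norm_ge_zero order_trans)

lemma B_nonneg: "0 \<le> B"
  using K_nonneg \<beta> by (simp add: B_def)

lemma LICQ_bound: "z \<in> M \<Longrightarrow> \<rho> * norm v \<le> norm (transpose (J z) *v v)"
  using reg Min_singular_values_le[of "J z" v] mult_right_mono[of \<rho> _ "norm v"]
  unfolding regular_problem_def LICQ_def by (meson norm_ge_zero order_trans)

lemma h_le: "z \<in> M \<Longrightarrow> norm (h z) \<le> \<beta>" and h_nth_le: "z \<in> M \<Longrightarrow> \<bar>h z $ i\<bar> \<le> \<beta>"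
  using component_le_norm_cart[of "h z" i] by (auto simp: near_feasible_def)

text \<open>The gap between the two bounds is the budget that the descent steps consume.\<close>

lemma pen_bounds: "z \<in> M \<Longrightarrow> - K \<le> pen z" "z \<in> M \<Longrightarrow> pen z \<le> K + \<sigma> * \<beta>\<^sup>2 / 2"
proof -
  assume z: "z \<in> M"
  have "\<bar>f z\<bar> \<le> K" using bounds_f(1) z by (simp add: bdd_lipschitz_fun_def)
  moreover have "infeas z \<le> \<beta>\<^sup>2 / 2" "0 \<le> infeas z"
    using power_mono[OF h_le[OF z], of 2] by (auto simp: infeas_def)
  moreover from this have "\<sigma> * infeas z \<le> \<sigma> * (\<beta>\<^sup>2 / 2)" "0 \<le> \<sigma> * infeas z"
    using \<sigma> by (auto intro: mult_left_mono)
  ultimately show "- K \<le> pen z" "pen z \<le> K + \<sigma> * \<beta>\<^sup>2 / 2"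
    unfolding pen_def by linarith+
qed

section \<open>First and second derivatives of the infeasibility along a line\<close>

definition "infeas1 y d s = (\<Sum>i\<in>UNIV. h (y + s *\<^sub>R d) $ i * (grad (coord h i) (y + s *\<^sub>R d) \<bullet> d))"

definition "infeas2 y d s = (\<Sum>i\<in>UNIV. (grad (coord h i) (y + s *\<^sub>R d) \<bullet> d)\<^sup>2 +
  h (y + s *\<^sub>R d) $ i * (d \<bullet> (hess (coord h i) (y + s *\<^sub>R d) *v d)))"

lemma infeas_derivs:
  "((\<lambda>s. infeas (y + s *\<^sub>R d)) has_real_derivative infeas1 y d s) (at s)"
  "(infeas1 y d has_real_derivative infeas2 y d s) (at s)"
proof -
  have "(norm (h z))\<^sup>2 = (\<Sum>i\<in>UNIV. (h z $ i)\<^sup>2)" for z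
    unfolding power2_norm_eq_inner inner_vec_def by (simp add: power2_eq_square)
  then show "((\<lambda>s. infeas (y + s *\<^sub>R d)) has_real_derivative infeas1 y d s) (at s)"
    unfolding infeas_def infeas1_def
    by (auto intro!: derivative_eq_intros C2_line_derivs(1)[OF C2h]
        simp: sum_divide_distrib sum_distrib_left intro!: sum.cong)
  show "(infeas1 y d has_real_derivative infeas2 y d s) (at s)"
    unfolding infeas1_def[abs_def] infeas2_def
    by (auto intro!: derivative_eq_intros C2_line_derivs[OF C2h] sum.cong simp: power2_eq_square)
qed

lemma infeas1_eq: "infeas1 y d 0 = (transpose (J y) *v h y) \<bullet> d"
  unfolding C2_jacobian(3)[OF C2h] by (simp add: infeas1_def inner_sum_left)

lemma infeas2_eq: "infeas2 y d 0 = (norm (J y *v d))\<^sup>2 + (\<Sum>i\<in>UNIV. h y $ i * (d \<bullet> (hess (coord h i) y *v d)))"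
  unfolding power2_norm_eq_inner inner_vec_def[of "J y *v d"] C2_jacobian(2)[OF C2h]
  by (simp add: infeas2_def sum.distrib power2_eq_square)

lemma infeas2_bounds:
  assumes seg: "\<And>s. 0 \<le> s \<Longrightarrow> s \<le> b \<Longrightarrow> y + s *\<^sub>R d \<in> M" and s: "0 \<le> s" "s \<le> b"
  shows "infeas2 y d s \<le> B * (norm d)\<^sup>2"
    and "infeas2 y d s \<le> infeas2 y d 0 + B * norm d ^ 3 * s"
proof -
  define z where "z = y + s *\<^sub>R d"
  have zM: "z \<in> M" and yM: "y \<in> M" using seg[OF s] seg[of 0] s by (auto simp: z_def)
  have dist: "dist z y = s * norm d" using s by (simp add: z_def dist_norm)
  let ?g = "\<lambda>i z. grad (coord h i) z \<bullet> d" and ?H = "\<lambda>i z. d \<bullet> (hess (coord h i) z *v d)"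
  have g: "\<bar>?g i w\<bar> \<le> K * norm d" and H: "\<bar>?H i w\<bar> \<le> K * (norm d)\<^sup>2" if "w \<in> M" for i w
    using directional_h(1,2) that by auto
  have dg: "\<bar>?g i z - ?g i y\<bar> \<le> K * norm d * s * norm d"
    and dH: "\<bar>?H i z - ?H i y\<bar> \<le> K * norm d * s * (norm d)\<^sup>2" for i
    using directional_h(3,4)[OF zM yM, where d = d and i = i] by (simp_all add: dist ac_simps)
  have dh: "\<bar>h z $ i - h y $ i\<bar> \<le> K * norm d * s" for i
    unfolding z_def
    by (rule line_lipschitz[OF C2h, where M = M]) (use bounds_h(1) seg s in \<open>auto simp: bdd_lipschitz_fun_def\<close>)
  have "(?g i z)\<^sup>2 + h z $ i * ?H i z \<le> (3 * K\<^sup>2 + \<beta> * K) * (norm d)\<^sup>2" for i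
  proof -
    have "(?g i z)\<^sup>2 \<le> (K * norm d)\<^sup>2"
      using power_mono[OF g[OF zM, of i] abs_ge_zero, of 2] by simp
    moreover have "\<bar>h z $ i * ?H i z\<bar> \<le> \<beta> * (K * (norm d)\<^sup>2)"
      unfolding abs_mult using \<beta> by (intro mult_mono h_nth_le H zM) auto
    moreover have "(3 * K\<^sup>2 + \<beta> * K) * (norm d)\<^sup>2 = 3 * (K * norm d)\<^sup>2 + \<beta> * (K * (norm d)\<^sup>2)"
      by (simp add: algebra_simps power_mult_distrib)
    ultimately show ?thesis using zero_le_power2[of "K * norm d"] unfolding abs_le_iff by linarith
  qed
  then have "infeas2 y d s \<le> (\<Sum>i\<in>(UNIV::'m set). (3 * K\<^sup>2 + \<beta> * K) * (norm d)\<^sup>2)"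
    unfolding infeas2_def z_def[symmetric] by (rule sum_mono)
  then show "infeas2 y d s \<le> B * (norm d)\<^sup>2" by (simp add: B_def)
  \<comment> \<open>The difference splits into the changes of the squared slope, of the factor
    \<open>h\<close> and of the Hessian, which contribute \<open>2 * K\<^sup>2\<close>,
    \<open>K\<^sup>2\<close> and \<open>\<beta> * K\<close> to the constant.\<close>
  have "(?g i z)\<^sup>2 + h z $ i * ?H i z \<le> (?g i y)\<^sup>2 + h y $ i * ?H i y + (3 * K\<^sup>2 + \<beta> * K) * norm d ^ 3 * s" for i
  proof -
    have "\<bar>(?g i z)\<^sup>2 - (?g i y)\<^sup>2\<bar> = \<bar>?g i z - ?g i y\<bar> * \<bar>?g i z + ?g i y\<bar>"
      by (simp add: power2_eq_square square_diff_square_factored abs_mult mult.commute)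
    also have "\<dots> \<le> (K * norm d * s * norm d) * (2 * (K * norm d))"
      using g[OF zM, of i] g[OF yM, of i] K_nonneg s by (intro mult_mono dg) auto
    finally have 1: "(?g i z)\<^sup>2 - (?g i y)\<^sup>2 \<le> 2 * K\<^sup>2 * norm d ^ 3 * s"
      by (simp add: power2_eq_square power3_eq_cube ac_simps)
    have "\<bar>(h z $ i - h y $ i) * ?H i z\<bar> \<le> (K * norm d * s) * (K * (norm d)\<^sup>2)"
      unfolding abs_mult using K_nonneg s by (intro mult_mono dh H zM) auto
    then have 2: "(h z $ i - h y $ i) * ?H i z \<le> K\<^sup>2 * norm d ^ 3 * s"
      by (simp add: power2_eq_square power3_eq_cube ac_simps abs_le_iff)
    have "\<bar>h y $ i * (?H i z - ?H i y)\<bar> \<le> \<beta> * (K * norm d * s * (norm d)\<^sup>2)"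
      unfolding abs_mult using \<beta> by (intro mult_mono dH h_nth_le yM) auto
    then have 3: "h y $ i * (?H i z - ?H i y) \<le> \<beta> * K * norm d ^ 3 * s"
      by (simp add: power2_eq_square power3_eq_cube ac_simps abs_le_iff)
    show ?thesis using 1 2 3 by (simp add: algebra_simps)
  qed
  then have "infeas2 y d s \<le> (\<Sum>i\<in>UNIV. (?g i y)\<^sup>2 + h y $ i * ?H i y + (3 * K\<^sup>2 + \<beta> * K) * norm d ^ 3 * s)"
    unfolding infeas2_def z_def[symmetric] by (rule sum_mono)
  then show "infeas2 y d s \<le> infeas2 y d 0 + B * norm d ^ 3 * s"
    by (simp add: infeas2_def[of y d 0] B_def sum.distrib)
qed

section \<open>Taylor estimates for the penalty function and the infeasibility\<close>

lemma pen_line_derivs: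
  "((\<lambda>s. pen (y + s *\<^sub>R d)) has_real_derivative grad f (y + s *\<^sub>R d) \<bullet> d + \<sigma> * infeas1 y d s) (at s)"
  "((\<lambda>s. grad f (y + s *\<^sub>R d) \<bullet> d + \<sigma> * infeas1 y d s) has_real_derivative
    d \<bullet> (hess f (y + s *\<^sub>R d) *v d) + \<sigma> * infeas2 y d s) (at s)"
  unfolding pen_def
  by (auto intro!: derivative_eq_intros C2_line_derivs[OF C2f] infeas_derivs)

lemma pen_grad_inner: "pen_grad y \<bullet> d = grad f y \<bullet> d + \<sigma> * infeas1 y d 0"
  by (simp add: pen_grad_def infeas1_eq inner_add_left matrix_vector_mult_scaleR del: transpose_matrix_vector)

text \<open>The second derivative of \<open>infeas\<close> has a squared Jacobian term and a term
  linear in \<open>h\<close>. The latter, scaled by \<sigma>, is the constraint part of the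
  Lagrangian Hessian.\<close>

lemma lag_hess_quadratic:
  "d \<bullet> (lag_hess y *v d) + \<sigma> * (norm (J y *v d))\<^sup>2 = d \<bullet> (hess f y *v d) + \<sigma> * infeas2 y d 0"
  unfolding infeas2_eq lag_hess_def
  by (simp add: matrix_vector_mult_add_rdistrib matrix_vector_mult_sum_left inner_add_right inner_sum_right
      sum_distrib_left algebra_simps flip: scaleR_matrix_vector_assoc)

text \<open>Stated up to a parameter \<open>b\<close>, because it is applied while it is still open
  whether the full step stays in \<open>M\<close>.\<close>

lemma infeas_descent:
  assumes seg: "\<And>s. 0 \<le> s \<Longrightarrow> s \<le> b \<Longrightarrow> y + s *\<^sub>R d \<in> M" and b: "0 \<le> b"
  shows "infeas (y + b *\<^sub>R d) \<le> infeas y + b * infeas1 y d 0 + B * (norm d)\<^sup>2 * b\<^sup>2 / 2"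
  using taylor_le[OF infeas_derivs[of y d], of b "B * (norm d)\<^sup>2" 0] infeas2_bounds(1)[OF seg] b by simp

text \<open>The quadratic estimate serves the gradient steps; the cubic one serves the curvature
  steps.\<close>

lemma pen_descent:
  assumes seg: "\<And>s. 0 \<le> s \<Longrightarrow> s \<le> 1 \<Longrightarrow> y + s *\<^sub>R d \<in> M"
  shows "pen (y + d) \<le> pen y + pen_grad y \<bullet> d + (K + \<sigma> * B) * (norm d)\<^sup>2 / 2"
    and "pen (y + d) \<le> pen y + pen_grad y \<bullet> d
      + (d \<bullet> (lag_hess y *v d) + \<sigma> * (norm (J y *v d))\<^sup>2) / 2 + (K + \<sigma> * B) * norm d ^ 3 / 6"
proof -
  have yM: "y \<in> M" using seg[of 0] by simp
  have "d \<bullet> (hess f (y + s *\<^sub>R d) *v d) + \<sigma> * infeas2 y d s \<le> (K + \<sigma> * B) * (norm d)\<^sup>2 + 0 * s"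
    if "0 \<le> s" "s \<le> 1" for s
  proof -
    have "\<sigma> * infeas2 y d s \<le> \<sigma> * (B * (norm d)\<^sup>2)"
      using infeas2_bounds(1)[OF seg, of 1 s] that \<sigma> by (intro mult_left_mono) auto
    then show ?thesis
      using directional_f(2)[OF seg seg, of s s d] that by (simp add: algebra_simps abs_le_iff)
  qed
  from taylor_le[OF pen_line_derivs[of y d] this, of 1]
  show "pen (y + d) \<le> pen y + pen_grad y \<bullet> d + (K + \<sigma> * B) * (norm d)\<^sup>2 / 2"
    by (simp add: pen_grad_inner)
  have "d \<bullet> (hess f (y + s *\<^sub>R d) *v d) + \<sigma> * infeas2 y d s
      \<le> (d \<bullet> (hess f y *v d) + \<sigma> * infeas2 y d 0) + (K + \<sigma> * B) * norm d ^ 3 * s"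
    if s: "0 \<le> s" "s \<le> 1" for s
  proof -
    have "dist (y + s *\<^sub>R d) y = s * norm d" using s by (simp add: dist_norm)
    then have "\<bar>d \<bullet> (hess f (y + s *\<^sub>R d) *v d) - d \<bullet> (hess f y *v d)\<bar> \<le> K * norm d ^ 3 * s"
      using directional_f(4)[OF seg[OF s] yM, of d] by (simp add: power2_eq_square power3_eq_cube ac_simps)
    moreover have "\<sigma> * infeas2 y d s \<le> \<sigma> * (infeas2 y d 0 + B * norm d ^ 3 * s)"
      using infeas2_bounds(2)[OF seg, of 1 s] s \<sigma> by (intro mult_left_mono) auto
    ultimately show ?thesis by (simp add: algebra_simps abs_le_iff)
  qed
  from taylor_le[OF pen_line_derivs[of y d] this, of 1]
  show "pen (y + d) \<le> pen y + pen_grad y \<bullet> d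
      + (d \<bullet> (lag_hess y *v d) + \<sigma> * (norm (J y *v d))\<^sup>2) / 2 + (K + \<sigma> * B) * norm d ^ 3 / 6"
    by (simp add: pen_grad_inner lag_hess_quadratic)
qed

section \<open>Steps that stay in the region of regularity\<close>

lemma continuous_on_h_line: "continuous_on S (\<lambda>s. h (y + s *\<^sub>R d))"
proof -
  have "continuous_on UNIV h"
    using C2_jacobian(1)[OF C2h] by (auto intro!: has_derivative_continuous_on[of UNIV])
  then show ?thesis
    by (rule continuous_on_compose2) (auto intro!: continuous_intros)
qed

text \<open>While the segment is in \<open>M\<close>, each component of \<open>h\<close> changes by
  at most \<open>K * norm d\<close>, so \<open>norm (h y)\<close> grows by less than
  \<open>\<beta> / 2\<close>.\<close>

lemma short_step_stays:
  assumes y: "norm (h y) < \<beta> / 2" and d: "real CARD('m) * K * norm d < \<beta> / 2"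
    and s: "0 \<le> s" "s \<le> 1"
  shows "y + s *\<^sub>R d \<in> M"
proof -
  let ?p = "\<lambda>s. norm (h (y + s *\<^sub>R d))"
  have "?p s \<le> \<beta>"
  proof (rule no_exit[where p = ?p, OF _ _ _ _ s])
    show cont: "continuous_on {0..1} ?p" by (intro continuous_on_norm continuous_on_h_line)
    show "?p 0 \<le> \<beta>" using y \<beta> by simp
    have "isCont ?p 0"
      using continuous_on_norm[OF continuous_on_h_line[of UNIV y d]] by (simp add: continuous_on_eq_continuous_at)
    then have "eventually (\<lambda>s. ?p s < \<beta>) (at 0)"
      using y \<beta> by (intro order_tendstoD(2)[where y = "?p 0"]) (auto simp: isCont_def)
    then obtain e where "e > 0" "\<And>s. s \<noteq> 0 \<Longrightarrow> dist s 0 < e \<Longrightarrow> ?p s < \<beta>"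
      by (auto simp: eventually_at)
    then show "\<exists>e>0. \<forall>s. 0 < s \<and> s < e \<longrightarrow> ?p s \<le> \<beta>"
      by (intro exI[of _ e]) (simp add: dist_real_def less_imp_le)
    fix a :: real assume a: "0 < a" "a < 1" and le: "\<And>s. 0 \<le> s \<Longrightarrow> s \<le> a \<Longrightarrow> ?p s \<le> \<beta>"
    have "\<bar>h (y + a *\<^sub>R d) $ i - h y $ i\<bar> \<le> K * norm d * a" for i
      by (rule line_lipschitz[OF C2h, where M = M])
        (use bounds_h(1) le a in \<open>auto simp: bdd_lipschitz_fun_def near_feasible_def\<close>)
    then have "norm (h (y + a *\<^sub>R d) - h y) \<le> (\<Sum>i\<in>(UNIV::'m set). K * norm d * a)"
      by (intro order_trans[OF norm_le_l1_cart] sum_mono) simp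
    also have "\<dots> = real CARD('m) * K * norm d * a" by simp
    also have "\<dots> \<le> real CARD('m) * K * norm d"
      using a K_nonneg by (intro mult_left_le) auto
    finally show "?p a < \<beta>"
      using y d norm_triangle_sub[of "h (y + a *\<^sub>R d)" "h y"] by linarith
  qed
  then show ?thesis by (simp add: near_feasible_def)
qed

text \<open>For parameters up to 1 the condition on \<open>d\<close> makes the quadratic Taylor term
  at most half of the linear decrease, so \<open>infeas\<close> falls below its initial value. This
  also covers \<open>y\<close> on the boundary of the region.\<close>

lemma infeas_step_stays:
  assumes y: "y \<in> M" and neg: "infeas1 y d 0 < 0" and d: "B * (norm d)\<^sup>2 \<le> - infeas1 y d 0"
    and s: "0 \<le> s" "s \<le> 1"
  shows "y + s *\<^sub>R d \<in> M"
proof -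
  have M: "z \<in> M \<longleftrightarrow> infeas z \<le> \<beta>\<^sup>2 / 2" for z
    using \<beta> by (simp add: near_feasible_def infeas_def abs_le_square_iff[symmetric])
  let ?p = "\<lambda>s. infeas (y + s *\<^sub>R d)"
  have p0: "?p 0 \<le> \<beta>\<^sup>2 / 2" using y M by simp
  have "?p s \<le> \<beta>\<^sup>2 / 2"
  proof (rule no_exit[where p = ?p, OF _ p0 _ _ s])
    show "continuous_on {0..1} ?p"
      unfolding infeas_def by (intro continuous_intros continuous_on_h_line) simp
    \<comment> \<open>On the boundary there is no slack and no Taylor bound yet; the negative slope
      alone gives the first short stretch.\<close>
    obtain e where "e > 0" "\<And>s. 0 < s \<Longrightarrow> s < e \<Longrightarrow> ?p s < ?p 0"
      using has_real_derivative_neg_dec_right[OF infeas_derivs(1)[of y d 0] neg] by auto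
    then show "\<exists>e>0. \<forall>s. 0 < s \<and> s < e \<longrightarrow> ?p s \<le> \<beta>\<^sup>2 / 2"
      using p0 by (intro exI[of _ e]) fastforce
    fix a :: real assume a: "0 < a" "a < 1" and le: "\<And>s. 0 \<le> s \<Longrightarrow> s \<le> a \<Longrightarrow> ?p s \<le> \<beta>\<^sup>2 / 2"
    have "?p a \<le> infeas y + a * infeas1 y d 0 + B * (norm d)\<^sup>2 * a\<^sup>2 / 2"
      using infeas_descent[of a y d] le a M by simp
    also have "B * (norm d)\<^sup>2 * a\<^sup>2 \<le> - infeas1 y d 0 * a"
      using mult_mono[OF d power_decreasing[of 1 2 a]] neg a by simp
    finally have "?p a \<le> infeas y + a * infeas1 y d 0 / 2" by (simp add: mult.commute)
    also have "\<dots> < infeas y" using a neg by (simp add: mult_pos_neg)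
    finally show "?p a < \<beta>\<^sup>2 / 2" using p0 by simp
  qed
  then show ?thesis using M by simp
qed

end


subsection \<open>The descent method\<close>

text \<open>A direction violating the curvature condition of \<open>AFAC\<close>, with its sign
  chosen so that the first-order term does not increase the penalty.\<close>

definition curvature_direction ::
    "real \<Rightarrow> real \<Rightarrow> real^'n \<Rightarrow> real^'n^'m \<Rightarrow> real^'n^'n \<Rightarrow> real^'n \<Rightarrow> bool" where
  "curvature_direction \<gamma> \<epsilon> g A H u \<longleftrightarrow>
    norm u = 1 \<and> norm (A *v u) \<le> \<gamma> \<and> u \<bullet> (H *v u) < - \<epsilon> \<and> g \<bullet> u \<le> 0"

text \<open>The problem enters only through the jet, as the oracle model demands, and
  \<open>None\<close> is the signal to stop. Choosing the direction by \<open>SOME\<close> is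
  legitimate since computation between calls is free.\<close>

fun descent_step ::
    "real \<Rightarrow> real \<Rightarrow> real \<Rightarrow> real \<Rightarrow> real \<Rightarrow> ('n::finite, 'm::finite) jet \<Rightarrow> (real^'n) option" where
  "descent_step \<sigma> L \<delta> \<epsilon> \<gamma> (fv, fg, fH, hv, A, hH) =
    (let g = fg + transpose A *v (\<sigma> *\<^sub>R hv);
         H = fH + (\<Sum>i\<in>UNIV. (\<sigma> *\<^sub>R hv) $ i *\<^sub>R hH $ i)
     in if \<delta> < norm g then Some (- (1 / L) *\<^sub>R g)
        else if \<exists>u. curvature_direction \<gamma> \<epsilon> g A H u
        then Some ((\<epsilon> / L) *\<^sub>R (SOME u. curvature_direction \<gamma> \<epsilon> g A H u))
        else None)"

text \<open>The fuel \<open>k\<close> only makes the decision tree finite; when it runs out, a dummy is returned.\<close>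

primrec penalty_alg ::
    "real \<Rightarrow> real \<Rightarrow> real \<Rightarrow> real \<Rightarrow> real \<Rightarrow> nat \<Rightarrow> real^'n \<Rightarrow> ('n::finite, 'm::finite) opt_alg" where
  "penalty_alg \<sigma> L \<delta> \<epsilon> \<gamma> 0 y = Return (y, 0)"
| "penalty_alg \<sigma> L \<delta> \<epsilon> \<gamma> (Suc k) y = Query y (\<lambda>j. case descent_step \<sigma> L \<delta> \<epsilon> \<gamma> j of
      None \<Rightarrow> Return (y, \<sigma> *\<^sub>R (case j of (_, _, _, hv, _) \<Rightarrow> hv))
    | Some d \<Rightarrow> penalty_alg \<sigma> L \<delta> \<epsilon> \<gamma> k (y + d))"

lemma evaluations_penalty_alg: "evaluations orc (penalty_alg \<sigma> L \<delta> \<epsilon> \<gamma> k y) \<le> k"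
  by (induction k arbitrary: y) (auto split: option.split)

text \<open>The factor 5 in the bounds on \<open>L\<close> lets gradient steps decrease
  \<open>infeas\<close> far from feasibility; the last bound keeps steps of both kinds short enough
  where \<open>norm (h y) < \<beta> / 2\<close>. Capping \<delta> by \<rho> serves the multiplier
  bound.\<close>

locale penalty_method = penalty f h \<beta> \<rho> K \<sigma>
  for f :: "real^'n \<Rightarrow> real" and h :: "real^'n \<Rightarrow> real^'m" and \<beta> \<rho> K \<sigma> :: real +
  fixes Lf R \<epsilon>0 \<epsilon>1 \<epsilon>2 \<gamma> L \<delta> :: real
  assumes Lf: "\<And>y. y \<in> M \<Longrightarrow> norm (grad f y) \<le> Lf"
    and R: "R = 2 + 2 * inverse \<rho> * Lf"
    and \<epsilon>0: "0 < \<epsilon>0" "\<epsilon>0 \<le> \<beta>" and \<epsilon>1: "0 < \<epsilon>1" and \<epsilon>2: "0 < \<epsilon>2"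
    and \<gamma>: "\<gamma>\<^sup>2 \<le> 1 / 16 * inverse (R ^ 3) * \<epsilon>0 * \<epsilon>2"
    and \<sigma>_eq: "\<sigma> = 2 * R / \<epsilon>0" and \<delta>: "\<delta> = min \<epsilon>1 \<rho>"
    and L: "0 < L" "5 * (K + \<sigma> * B) \<le> L"
      "2 * real CARD('m) * K\<^sup>2 * (1 / \<beta> + \<sigma> * real CARD('m)) < L"
begin

lemma Lf_nonneg: "0 \<le> Lf"
  using Lf nonempty by (meson ex_in_conv norm_ge_zero order_trans)

lemma R_ge: "2 \<le> R"
  using Lf_nonneg \<rho> by (simp add: R)

lemma \<sigma>\<beta>: "2 * R \<le> \<sigma> * \<beta>"
  using \<epsilon>0 R_ge by (simp add: \<sigma>_eq field_simps)

lemma L_\<beta>: "2 * real CARD('m) * K\<^sup>2 * (1 + \<sigma> * real CARD('m) * \<beta>) < L * \<beta>"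
proof -
  have "1 + \<sigma> * real CARD('m) * \<beta> = (1 / \<beta> + \<sigma> * real CARD('m)) * \<beta>"
    using \<beta> by (simp add: field_simps)
  then show ?thesis
    using mult_strict_right_mono[OF L(3) \<beta>] by (simp only: mult.assoc)
qed

text \<open>The decrease follows from \<open>pen_descent\<close> because
  \<open>K + \<sigma> * B \<le> L\<close>. The effort goes into keeping the segment in
  \<open>M\<close>, by a short step if \<open>norm (h y) < \<beta> / 2\<close> and by decreasing
  \<open>infeas\<close> otherwise.\<close>

lemma gradient_step:
  assumes y: "y \<in> M" and d: "d = - (1 / L) *\<^sub>R pen_grad y"
  shows "y + d \<in> M" and "pen (y + d) \<le> pen y - (norm (pen_grad y))\<^sup>2 / (2 * L)"
proof -
  define g where "g = pen_grad y"
  define w where "w = transpose (J y) *v h y"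
  have g: "g = grad f y + \<sigma> *\<^sub>R w"
    by (simp add: g_def pen_grad_def w_def matrix_vector_mult_scaleR del: transpose_matrix_vector)
  have d: "d = - (1 / L) *\<^sub>R g" using d by (simp add: g_def)
  have nd: "norm d = norm g / L" using L by (simp add: d)
  have seg: "y + s *\<^sub>R d \<in> M" if s: "0 \<le> s" "s \<le> 1" for s
  proof (cases "norm (h y) < \<beta> / 2")
    case True
    have "norm w \<le> (\<Sum>i\<in>(UNIV::'m set). \<beta> * K)"
      unfolding w_def C2_jacobian(3)[OF C2h] using y bounds_h(1) \<beta>
      by (intro order_trans[OF norm_sum] sum_mono)
        (auto simp: bdd_lipschitz_fun_def intro!: mult_mono h_nth_le)
    then have "\<sigma> * norm w \<le> \<sigma> * (real CARD('m) * (\<beta> * K))"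
      using \<sigma> by (intro mult_left_mono) auto
    moreover have "norm g \<le> K + \<sigma> * norm w"
      using norm_triangle_ineq[of "grad f y" "\<sigma> *\<^sub>R w"] bounds_f(2) y \<sigma>
      unfolding g bdd_lipschitz_fun_def by fastforce
    ultimately have "norm g \<le> K * (1 + \<sigma> * real CARD('m) * \<beta>)"
      by (simp add: algebra_simps)
    then have "real CARD('m) * K * norm g \<le> real CARD('m) * K * (K * (1 + \<sigma> * real CARD('m) * \<beta>))"
      using K_nonneg by (intro mult_left_mono) auto
    also have "\<dots> < L * \<beta> / 2" using L_\<beta> by (simp add: power2_eq_square algebra_simps)
    finally have "real CARD('m) * K * norm d < \<beta> / 2"
      using L(1) by (simp add: nd field_simps)
    with True show ?thesis using s by (rule short_step_stays)
  next
    case False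
    \<comment> \<open>Here \<open>\<sigma> \<parallel>w\<parallel> \<ge> 2 Lf\<close>, so \<open>- g\<close> is a descent direction for \<open>infeas\<close>.\<close>
    have "\<rho> * (\<beta> / 2) \<le> norm w"
      using LICQ_bound[OF y, of "h y"] False \<rho> mult_left_mono[of "\<beta> / 2" "norm (h y)" \<rho>]
      unfolding w_def by linarith
    then have "\<sigma> * (\<rho> * (\<beta> / 2)) \<le> \<sigma> * norm w" using \<sigma> by (intro mult_left_mono) auto
    moreover have "\<rho> * (2 * R) \<le> \<rho> * (\<sigma> * \<beta>)" using \<sigma>\<beta> \<rho> by (intro mult_left_mono) auto
    moreover have "\<rho> * R = 2 * \<rho> + 2 * Lf" using \<rho> by (simp add: R field_simps)
    ultimately have sw: "2 * \<rho> + 2 * Lf \<le> \<sigma> * norm w" by (simp add: algebra_simps)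
    \<comment> \<open>\<open>q\<close> is the size of the penalty part of \<open>g\<close>; the
      objective part is at most half of it.\<close>
    define q where "q = \<sigma> * norm w"
    have q: "0 < q" "Lf \<le> q / 2" using sw \<rho> Lf_nonneg by (auto simp: q_def)
    have w0: "0 < norm w" using q(1) \<sigma> by (simp add: q_def zero_less_mult_iff)
    have "\<bar>w \<bullet> grad f y\<bar> \<le> norm w * (q / 2)"
      using Cauchy_Schwarz_ineq2 Lf[OF y] q(2)
      by (rule order_trans[OF _ mult_left_mono[OF order_trans]]) simp
    moreover have "w \<bullet> (\<sigma> *\<^sub>R w) = norm w * q"
      by (simp add: q_def power2_norm_eq_inner[symmetric] power2_eq_square)
    ultimately have wg: "norm w * (q / 2) \<le> w \<bullet> g"
      unfolding g inner_add_right abs_le_iff by argo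
    have i1: "infeas1 y d 0 = - (w \<bullet> g) / L"
      by (simp add: infeas1_eq d w_def del: transpose_matrix_vector)
    have "norm g \<le> 3 / 2 * q"
      using norm_triangle_ineq[of "grad f y" "\<sigma> *\<^sub>R w"] Lf[OF y] q \<sigma> unfolding g q_def by simp
    then have "(norm g)\<^sup>2 \<le> (3 / 2 * q)\<^sup>2" by (rule power_mono) simp
    then have "B * (norm g)\<^sup>2 \<le> B * (9 / 4 * q\<^sup>2)"
      using B_nonneg by (intro mult_left_mono) (auto simp: power2_eq_square)
    also have "\<dots> = 9 / 4 * (\<sigma> * B) * (norm w * q)" by (simp add: q_def power2_eq_square)
    \<comment> \<open>The constant \<open>9 / 4\<close> is the square of \<open>3 / 2\<close> from
      the bound on \<open>norm g\<close>; it fits because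
      \<open>5 * (\<sigma> * B) \<le> L\<close>.\<close>
    also have "\<dots> \<le> L / 2 * (norm w * q)"
    proof (rule mult_right_mono)
      have "0 \<le> \<sigma> * B" using \<sigma> B_nonneg by simp
      then show "9 / 4 * (\<sigma> * B) \<le> L / 2" using L(2) K_nonneg by argo
    qed (use q w0 in simp)
    also have "\<dots> \<le> L * (w \<bullet> g)" using mult_left_mono[OF wg, of L] L(1) by simp
    finally have "B * (norm g)\<^sup>2 / (L * L) \<le> L * (w \<bullet> g) / (L * L)"
      using L(1) by (intro divide_right_mono) auto
    then have "B * (norm d)\<^sup>2 \<le> - infeas1 y d 0"
      using L(1) by (simp add: i1 nd power_divide power2_eq_square)
    moreover have "0 < w \<bullet> g" using wg mult_pos_pos[OF w0, of "q / 2"] q(1) by linarith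
    then have "infeas1 y d 0 < 0" using L(1) by (simp add: i1 divide_neg_pos)
    ultimately show ?thesis using infeas_step_stays[OF y _ _ s] by blast
  qed
  show "y + d \<in> M" using seg[of 1] by simp
  have "pen (y + d) \<le> pen y + g \<bullet> d + (K + \<sigma> * B) * (norm d)\<^sup>2 / 2"
    unfolding g_def using pen_descent(1)[OF seg] by simp
  also have "(K + \<sigma> * B) * (norm d)\<^sup>2 \<le> L * (norm d)\<^sup>2"
    using L K_nonneg B_nonneg \<sigma> by (intro mult_right_mono) auto
  also have "L * (norm d)\<^sup>2 = (norm g)\<^sup>2 / L"
    using L(1) by (simp add: nd power_divide power2_eq_square)
  also have "g \<bullet> d = - ((norm g)\<^sup>2 / L)"
    by (simp add: d power2_norm_eq_inner)
  finally show "pen (y + d) \<le> pen y - (norm (pen_grad y))\<^sup>2 / (2 * L)"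
    by (simp add: g_def)
qed

text \<open>LICQ bounds \<rho> times the norm of the multiplier by \<open>\<delta> + Lf\<close>,
  hence by \<open>\<rho> + Lf = \<rho> * (R / 2)\<close>. Dividing by
  \<open>\<sigma> = 2 * R / \<epsilon>0\<close> bounds \<open>h y\<close>.\<close>

lemma multiplier_bound:
  assumes y: "y \<in> M" and small: "norm (pen_grad y) \<le> \<delta>"
  shows "norm (\<sigma> *\<^sub>R h y) \<le> R / 2" and "norm (h y) \<le> \<epsilon>0 / 4"
proof -
  have "\<rho> * norm (\<sigma> *\<^sub>R h y) \<le> norm (pen_grad y - grad f y)"
    using LICQ_bound[OF y, of "\<sigma> *\<^sub>R h y"] by (simp add: pen_grad_def del: transpose_matrix_vector)
  also have "\<dots> \<le> \<rho> + Lf"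
    using norm_triangle_ineq4[of "pen_grad y" "grad f y"] small Lf[OF y] by (simp add: \<delta>)
  also have "\<dots> = \<rho> * (R / 2)" using \<rho> by (simp add: R field_simps)
  finally show R2: "norm (\<sigma> *\<^sub>R h y) \<le> R / 2" using \<rho> by simp
  then show "norm (h y) \<le> \<epsilon>0 / 4"
    using R_ge \<epsilon>0 \<sigma> unfolding \<sigma>_eq by (simp add: field_simps)
qed

text \<open>With step length \<open>t = \<epsilon>2 / L\<close>, the second-order term gains at
  least \<open>L * t ^ 3 / 4\<close> and the cubic remainder costs at most
  \<open>L * t ^ 3 / 6\<close>; the difference is \<open>L * t ^ 3 / 12\<close>.\<close>

lemma curvature_step:
  assumes y: "y \<in> M" and small: "norm (pen_grad y) \<le> \<delta>"
    and u: "curvature_direction \<gamma> \<epsilon>2 (pen_grad y) (J y) (lag_hess y) u"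
    and d: "d = (\<epsilon>2 / L) *\<^sub>R u"
  shows "y + d \<in> M" and "pen (y + d) \<le> pen y - \<epsilon>2 ^ 3 / (12 * L\<^sup>2)"
proof -
  have u: "norm u = 1" "norm (J y *v u) \<le> \<gamma>" "u \<bullet> (lag_hess y *v u) < - \<epsilon>2" "pen_grad y \<bullet> u \<le> 0"
    using u by (auto simp: curvature_direction_def)
  define t where "t = \<epsilon>2 / L"
  have t: "0 < t" "\<epsilon>2 = L * t" using \<epsilon>2 L(1) by (auto simp: t_def)
  have nd: "norm d = t" using t(1) by (simp add: d u t_def[symmetric])
  \<comment> \<open>The tolerance \<epsilon>2 has no upper bound of its own. The existence of
    \<open>u\<close> forces it below the norm of the Lagrangian Hessian, which makes the step
    short.\<close>
  have "u \<bullet> (lag_hess y *v u) = u \<bullet> (hess f y *v u) +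
      (\<Sum>i\<in>UNIV. (\<sigma> *\<^sub>R h y) $ i * (u \<bullet> (hess (coord h i) y *v u)))"
    unfolding lag_hess_def
    by (simp add: matrix_vector_mult_add_rdistrib matrix_vector_mult_sum_left inner_add_right
        inner_sum_right flip: scaleR_matrix_vector_assoc)
  moreover have "\<bar>u \<bullet> (hess f y *v u)\<bar> \<le> K"
    using directional_f(2)[OF y y, of u] u by simp
  moreover have "\<bar>\<Sum>i\<in>UNIV. (\<sigma> *\<^sub>R h y) $ i * (u \<bullet> (hess (coord h i) y *v u))\<bar>
      \<le> (\<Sum>i\<in>(UNIV::'m set). R / 2 * K)"
  proof (intro order_trans[OF sum_abs] sum_mono)
    fix i :: 'm
    have "\<bar>(\<sigma> *\<^sub>R h y) $ i\<bar> \<le> R / 2"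
      using component_le_norm_cart multiplier_bound(1)[OF y small] by (rule order_trans)
    then show "\<bar>(\<sigma> *\<^sub>R h y) $ i * (u \<bullet> (hess (coord h i) y *v u))\<bar> \<le> R / 2 * K"
      unfolding abs_mult using directional_h(2)[OF y y, where d = u and i = i] u R_ge
      by (intro mult_mono) auto
  qed
  ultimately have "\<epsilon>2 \<le> K + (\<Sum>i\<in>(UNIV::'m set). R / 2 * K)"
    using u(3) by linarith
  also have "\<dots> = K * (1 + R / 2 * real CARD('m))"
    by (simp add: algebra_simps)
  also have "\<dots> \<le> K * (1 + \<sigma> * real CARD('m) * \<beta>)"
    using \<sigma>\<beta> R_ge K_nonneg mult_right_mono[of "R / 2" "\<sigma> * \<beta>" "real CARD('m)"]
    by (intro mult_left_mono) (auto simp: algebra_simps)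
  finally have "real CARD('m) * K * (L * t) \<le> real CARD('m) * K * (K * (1 + \<sigma> * real CARD('m) * \<beta>))"
    using K_nonneg t(2) by (intro mult_left_mono) auto
  also have "\<dots> < L * \<beta> / 2" using L_\<beta> by (simp add: power2_eq_square algebra_simps)
  finally have "real CARD('m) * K * norm d < \<beta> / 2"
    using L(1) by (simp add: nd field_simps)
  moreover have "norm (h y) < \<beta> / 2"
    using multiplier_bound(2)[OF y small] \<epsilon>0 by simp
  ultimately have seg: "y + s *\<^sub>R d \<in> M" if "0 \<le> s" "s \<le> 1" for s
    using short_step_stays that by blast
  show "y + d \<in> M" using seg[of 1] by simp
  \<comment> \<open>The Lagrangian curvature is below \<open>- \<epsilon>2\<close>; the bound on
    \<gamma> ensures that the Jacobian term spoils at most half of it.\<close>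
  have "\<sigma> * \<gamma>\<^sup>2 \<le> \<sigma> * (1 / 16 * inverse (R ^ 3) * \<epsilon>0 * \<epsilon>2)"
    using \<gamma> \<sigma> by (intro mult_left_mono) auto
  also have "\<dots> = \<epsilon>2 / (8 * R\<^sup>2)"
    using R_ge \<epsilon>0 by (simp add: \<sigma>_eq field_simps power2_eq_square power3_eq_cube)
  also have "\<dots> \<le> \<epsilon>2 / 2"
    using R_ge \<epsilon>2 power_mono[of 2 R 2] by (intro divide_left_mono) auto
  finally have \<sigma>\<gamma>: "\<sigma> * \<gamma>\<^sup>2 \<le> \<epsilon>2 / 2" .
  have "(norm (J y *v u))\<^sup>2 \<le> \<gamma>\<^sup>2" using u(2) by (rule power_mono) simp
  then have "\<sigma> * (norm (J y *v u))\<^sup>2 \<le> \<sigma> * \<gamma>\<^sup>2" using \<sigma> by (intro mult_left_mono) auto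
  then have "u \<bullet> (lag_hess y *v u) + \<sigma> * (norm (J y *v u))\<^sup>2 \<le> - (\<epsilon>2 / 2)"
    using u(3) \<sigma>\<gamma> by linarith
  then have "t\<^sup>2 * (u \<bullet> (lag_hess y *v u) + \<sigma> * (norm (J y *v u))\<^sup>2) \<le> t\<^sup>2 * - (\<epsilon>2 / 2)"
    by (intro mult_left_mono) auto
  moreover have "t\<^sup>2 * - (\<epsilon>2 / 2) = - (L * t ^ 3 / 2)"
    by (simp add: t(2) power2_eq_square power3_eq_cube)
  moreover have "d \<bullet> (lag_hess y *v d) + \<sigma> * (norm (J y *v d))\<^sup>2
      = t\<^sup>2 * (u \<bullet> (lag_hess y *v u) + \<sigma> * (norm (J y *v u))\<^sup>2)"
    using t(1) unfolding d t_def[symmetric]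
    by (simp add: matrix_vector_mult_scaleR power2_eq_square algebra_simps)
  ultimately have q: "d \<bullet> (lag_hess y *v d) + \<sigma> * (norm (J y *v d))\<^sup>2 \<le> - (L * t ^ 3 / 2)"
    by simp
  have "pen_grad y \<bullet> d \<le> 0"
    using u(4) t(1) unfolding d t_def[symmetric] by (simp add: mult_nonneg_nonpos)
  moreover have "(K + \<sigma> * B) * norm d ^ 3 \<le> L * t ^ 3"
    unfolding nd using L K_nonneg B_nonneg \<sigma> t(1) by (intro mult_right_mono) auto
  moreover have "pen (y + d) \<le> pen y + pen_grad y \<bullet> d
      + (d \<bullet> (lag_hess y *v d) + \<sigma> * (norm (J y *v d))\<^sup>2) / 2 + (K + \<sigma> * B) * norm d ^ 3 / 6"
    using seg by (rule pen_descent(2))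
  ultimately have "pen (y + d) \<le> pen y - L * t ^ 3 / 12"
    using q by argo
  also have "L * t ^ 3 / 12 = \<epsilon>2 ^ 3 / (12 * L\<^sup>2)"
    using L(1) by (simp add: t_def power2_eq_square power3_eq_cube field_simps)
  finally show "pen (y + d) \<le> pen y - \<epsilon>2 ^ 3 / (12 * L\<^sup>2)" .
qed

section \<open>Correctness of the descent method\<close>

definition "decrease = min (\<delta>\<^sup>2 / (2 * L)) (\<epsilon>2 ^ 3 / (12 * L\<^sup>2))"

lemma descent_step_jet:
  "descent_step \<sigma> L \<delta> \<epsilon>2 \<gamma> (jet_oracle f h y) =
    (if \<delta> < norm (pen_grad y) then Some (- (1 / L) *\<^sub>R pen_grad y)
     else if \<exists>u. curvature_direction \<gamma> \<epsilon>2 (pen_grad y) (J y) (lag_hess y) u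
     then Some ((\<epsilon>2 / L) *\<^sub>R (SOME u. curvature_direction \<gamma> \<epsilon>2 (pen_grad y) (J y) (lag_hess y) u))
     else None)"
  by (auto simp: jet_oracle_def pen_grad_def lag_hess_def Let_def)

lemma descent_step_Some:
  assumes y: "y \<in> M" and d: "descent_step \<sigma> L \<delta> \<epsilon>2 \<gamma> (jet_oracle f h y) = Some d"
  shows "y + d \<in> M" and "pen (y + d) \<le> pen y - decrease"
proof -
  have "y + d \<in> M \<and> pen (y + d) \<le> pen y - decrease"
  proof (cases "\<delta> < norm (pen_grad y)")
    case True
    have "\<delta>\<^sup>2 / (2 * L) \<le> (norm (pen_grad y))\<^sup>2 / (2 * L)"
      using True L(1) \<epsilon>1 \<rho> by (intro divide_right_mono power_mono) (auto simp: \<delta>)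
    then show ?thesis
      using gradient_step[OF y, of d] d True by (auto simp: descent_step_jet decrease_def)
  next
    case False
    let ?P = "curvature_direction \<gamma> \<epsilon>2 (pen_grad y) (J y) (lag_hess y)"
    have ex: "\<exists>u. ?P u" and d: "d = (\<epsilon>2 / L) *\<^sub>R (SOME u. ?P u)"
      using d False by (auto simp: descent_step_jet split: if_splits)
    from curvature_step[OF y _ someI_ex[OF ex] d] show ?thesis
      using False by (auto simp: decrease_def)
  qed
  then show "y + d \<in> M" and "pen (y + d) \<le> pen y - decrease" by auto
qed

text \<open>Since \<open>u\<close> and \<open>- u\<close> have the same curvature and one of them
  satisfies the sign condition, the absence of a \<open>curvature_direction\<close> is the full
  curvature condition of \<open>AFAC\<close>.\<close>

lemma descent_step_None:
  assumes y: "y \<in> M" and n: "descent_step \<sigma> L \<delta> \<epsilon>2 \<gamma> (jet_oracle f h y) = None"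
  shows "AFAC \<epsilon>0 \<epsilon>1 \<epsilon>2 \<gamma> f h y (\<sigma> *\<^sub>R h y)" and "norm (\<sigma> *\<^sub>R h y) \<le> R"
proof -
  have small: "norm (pen_grad y) \<le> \<delta>"
    and none: "\<And>u. \<not> curvature_direction \<gamma> \<epsilon>2 (pen_grad y) (J y) (lag_hess y) u"
    using n by (auto simp: descent_step_jet split: if_splits)
  have curv: "- \<epsilon>2 \<le> u \<bullet> (lag_hess y *v u)" if "norm u = 1" "norm (J y *v u) \<le> \<gamma>" for u
  proof (rule ccontr)
    assume "\<not> - \<epsilon>2 \<le> u \<bullet> (lag_hess y *v u)"
    then have "curvature_direction \<gamma> \<epsilon>2 (pen_grad y) (J y) (lag_hess y)
        (if pen_grad y \<bullet> u \<le> 0 then u else - u)"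
      using that by (auto simp: curvature_direction_def linear_neg[OF matrix_vector_mul_linear])
    with none show False by blast
  qed
  show "norm (\<sigma> *\<^sub>R h y) \<le> R"
    using multiplier_bound(1)[OF y small] R_ge by linarith
  show "AFAC \<epsilon>0 \<epsilon>1 \<epsilon>2 \<gamma> f h y (\<sigma> *\<^sub>R h y)"
    unfolding AFAC_def lagrangian_derivs[OF C2f C2h] pen_grad_def[symmetric] lag_hess_def[symmetric]
    using multiplier_bound(2)[OF y small] \<epsilon>0 small curv by (auto simp: \<delta>)
qed

text \<open>A potential argument: \<open>pen y + K\<close> is nonnegative on \<open>M\<close> and
  drops by \<open>decrease\<close> per step, as does the right-hand side. Without fuel the strict
  inequality is contradictory, so the dummy is never returned.\<close>

lemma penalty_alg_correct:
  assumes "y \<in> M" and "pen y + K < real k * decrease"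
    and "result (jet_oracle f h) (penalty_alg \<sigma> L \<delta> \<epsilon>2 \<gamma> k y) = (z, v)"
  shows "AFAC \<epsilon>0 \<epsilon>1 \<epsilon>2 \<gamma> f h z v \<and> norm v \<le> R"
  using assms
proof (induction k arbitrary: y)
  case 0
  then show ?case using pen_bounds(1)[of y] by simp
next
  case (Suc k)
  show ?case
  proof (cases "descent_step \<sigma> L \<delta> \<epsilon>2 \<gamma> (jet_oracle f h y)")
    case None
    then show ?thesis
      using descent_step_None[OF Suc.prems(1)] Suc.prems(3) by (auto simp: jet_oracle_def)
  next
    case (Some d)
    note step = descent_step_Some[OF Suc.prems(1) Some]
    show ?thesis
      using Suc.IH[OF step(1)] step(2) Suc.prems(2,3) Some by (auto simp: algebra_simps)
  qed
qed

end


subsection \<open>Complexity\<close>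

text \<open>\<open>T / \<epsilon>0\<close> stands for the oscillation of the penalty and the minimum
  for the decrease per step. The summand 2, due to rounding, is absorbed because the maximum is at
  least \<open>1 / \<beta>\<^sup>2\<close>.\<close>

lemma iteration_count_bound:
  fixes \<beta> \<rho> c T \<epsilon>0 \<epsilon>1 \<epsilon>2 :: real
  assumes "0 < \<rho>" "0 < c" "0 \<le> T" and \<epsilon>0: "0 < \<epsilon>0" "\<epsilon>0 \<le> \<beta>" and \<epsilon>1: "0 < \<epsilon>1" "\<epsilon>1 \<le> 1"
    and \<epsilon>2: "0 < \<epsilon>2"
  shows "T / \<epsilon>0 / min ((min \<epsilon>1 \<rho>)\<^sup>2 / (2 * (c / \<epsilon>0))) (\<epsilon>2 ^ 3 / (12 * (c / \<epsilon>0)\<^sup>2)) + 2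
    \<le> (2 * c * T / (min 1 \<rho>)\<^sup>2 + 12 * c\<^sup>2 * T + 2 * \<beta>\<^sup>2)
      * max (1 / (\<epsilon>0\<^sup>2 * \<epsilon>1\<^sup>2)) (1 / (\<epsilon>0 ^ 3 * \<epsilon>2 ^ 3))"
    (is "T / \<epsilon>0 / min ?D1 ?D2 + 2 \<le> (?C1 + ?C2 + ?C3) * max ?X1 ?X2")
proof -
  let ?X = "max ?X1 ?X2"
  have C: "0 \<le> ?C1" "0 \<le> ?C2" "0 \<le> ?C3" using assms by simp_all
  have X: "0 \<le> ?X" using \<epsilon>0 \<epsilon>1 by (simp add: le_max_iff_disj)
  \<comment> \<open>Trading the threshold for a fixed multiple of \<epsilon>1 moves \<rho> into the
    constant; this uses \<open>\<epsilon>1 \<le> 1\<close>.\<close>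
  have "min 1 \<rho> * \<epsilon>1 \<le> min \<epsilon>1 \<rho>"
    using mult_mono[of "min 1 \<rho>" 1 \<epsilon>1 \<epsilon>1] mult_mono[of "min 1 \<rho>" \<rho> \<epsilon>1 1] assms by simp
  then have "(min 1 \<rho> * \<epsilon>1)\<^sup>2 \<le> (min \<epsilon>1 \<rho>)\<^sup>2"
    using assms by (intro power_mono) auto
  then have le: "2 * c * T / (\<epsilon>0\<^sup>2 * (min \<epsilon>1 \<rho>)\<^sup>2) \<le> 2 * c * T / (\<epsilon>0\<^sup>2 * (min 1 \<rho> * \<epsilon>1)\<^sup>2)"
    using assms by (intro divide_left_mono mult_left_mono mult_pos_pos) auto
  have "T / \<epsilon>0 / ?D1 = 2 * c * T / (\<epsilon>0\<^sup>2 * (min \<epsilon>1 \<rho>)\<^sup>2)"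
    by (simp add: power2_eq_square ac_simps)
  also note le
  also have "2 * c * T / (\<epsilon>0\<^sup>2 * (min 1 \<rho> * \<epsilon>1)\<^sup>2) = ?C1 * ?X1"
    by (simp add: power_mult_distrib ac_simps)
  also have "\<dots> \<le> ?C1 * ?X" using C by (intro mult_left_mono) auto
  finally have 1: "T / \<epsilon>0 / ?D1 \<le> ?C1 * ?X" .
  have "T / \<epsilon>0 / ?D2 = ?C2 * ?X2"
    using \<epsilon>0 by (simp add: power2_eq_square power3_eq_cube ac_simps)
  also have "\<dots> \<le> ?C2 * ?X" using C by (intro mult_left_mono) auto
  finally have 2: "T / \<epsilon>0 / ?D2 \<le> ?C2 * ?X" .
  have "min ?D1 ?D2 = ?D1 \<or> min ?D1 ?D2 = ?D2" by linarith
  then have "T / \<epsilon>0 / min ?D1 ?D2 \<le> ?C1 * ?X + ?C2 * ?X"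
    using 1 2 mult_nonneg_nonneg[OF C(1) X] mult_nonneg_nonneg[OF C(2) X]
    by (elim disjE; simp only:; linarith)
  moreover have "2 \<le> ?C3 * ?X"
  proof -
    have "\<epsilon>0\<^sup>2 * \<epsilon>1\<^sup>2 \<le> \<beta>\<^sup>2 * 1\<^sup>2"
      using \<epsilon>0 \<epsilon>1 by (intro mult_mono power_mono) auto
    then have "2 \<le> ?C3 * ?X1" using \<epsilon>0 \<epsilon>1 by (simp add: field_simps)
    also have "\<dots> \<le> ?C3 * ?X" using C by (intro mult_left_mono) auto
    finally show ?thesis .
  qed
  ultimately show ?thesis unfolding distrib_right by linarith
qed

theorem theorem2p6:
  fixes \<beta> \<rho> K Lf R :: real
  assumes "\<beta> > 0" and "\<rho> > 0"
    and "R = 2 + 2 * inverse \<rho> * Lf"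
  shows "\<exists>(alg :: real \<Rightarrow> real \<Rightarrow> real \<Rightarrow> real \<Rightarrow> real^'n \<Rightarrow> ('n, 'm) opt_alg) (C :: real).
    \<forall>\<epsilon>0 \<epsilon>1 \<epsilon>2 \<gamma>.
      \<epsilon>0 > 0 \<and> \<epsilon>1 > 0 \<and> \<epsilon>2 > 0 \<and> \<gamma> \<ge> 0 \<and> \<epsilon>0 \<le> \<beta> \<and> \<epsilon>1 \<le> 1 \<and>
      \<epsilon>1\<^sup>2 \<le> 1 / 16 * inverse R * \<epsilon>0 * \<epsilon>2 \<and>
      \<gamma>\<^sup>2 \<le> 1 / 16 * inverse (R ^ 3) * \<epsilon>0 * \<epsilon>2 \<longrightarrow>
      (\<forall>(f :: real^'n \<Rightarrow> real) (h :: real^'n \<Rightarrow> real^'m) y0.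
        regular_problem \<beta> \<rho> K f h \<and> y0 \<in> near_feasible h \<beta> \<and>
        Lf = (SUP y\<in>near_feasible h \<beta>. norm (grad f y)) \<longrightarrow>
        (let orc = jet_oracle f h;
             run = alg \<epsilon>0 \<epsilon>1 \<epsilon>2 \<gamma> y0;
             (y, lam) = result orc run
         in AFAC \<epsilon>0 \<epsilon>1 \<epsilon>2 \<gamma> f h y lam \<and> norm lam \<le> R \<and>
            real (evaluations orc run)
              \<le> C * max (1 / (\<epsilon>0\<^sup>2 * \<epsilon>1\<^sup>2)) (1 / (\<epsilon>0 ^ 3 * \<epsilon>2 ^ 3))))"
proof -
  define m where "m = real CARD('m)"
  define B where "B = m * (3 * K\<^sup>2 + \<beta> * K)"
  \<comment> \<open>Chosen so that \<open>c / \<epsilon>0\<close> meets the bounds on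
    \<open>L\<close>: here \<open>\<sigma> * \<epsilon>0 = 2 * R\<close>, and
    \<open>\<epsilon>0 \<le> \<beta>\<close> handles the terms without \<sigma>. The leading 1 gives
    positivity and strictness.\<close>
  define c where "c = 1 + 5 * (K * \<beta> + 2 * R * B) + 2 * m * K\<^sup>2 * (1 + 2 * R * m)"
  \<comment> \<open>\<open>T / \<epsilon>0\<close> dominates
    \<open>2 * K + \<sigma> * \<beta>\<^sup>2 / 2\<close>, the gap in
    \<open>pen_bounds\<close>.\<close>
  define T where "T = 2 * K * \<beta> + R * \<beta>\<^sup>2"
  define D where "D = (\<lambda>\<epsilon>0 \<epsilon>1 \<epsilon>2 :: real.
    min ((min \<epsilon>1 \<rho>)\<^sup>2 / (2 * (c / \<epsilon>0))) (\<epsilon>2 ^ 3 / (12 * (c / \<epsilon>0)\<^sup>2)))"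
  \<comment> \<open>The added 1 gives the strict inequality that \<open>penalty_alg_correct\<close>
    asks for, even if the quotient is an integer.\<close>
  define k where "k = (\<lambda>\<epsilon>0 \<epsilon>1 \<epsilon>2. nat \<lceil>T / \<epsilon>0 / D \<epsilon>0 \<epsilon>1 \<epsilon>2\<rceil> + 1)"
  define alg :: "real \<Rightarrow> real \<Rightarrow> real \<Rightarrow> real \<Rightarrow> real^'n \<Rightarrow> ('n, 'm) opt_alg" where
    "alg = (\<lambda>\<epsilon>0 \<epsilon>1 \<epsilon>2 \<gamma>. penalty_alg (2 * R / \<epsilon>0) (c / \<epsilon>0) (min \<epsilon>1 \<rho>) \<epsilon>2 \<gamma> (k \<epsilon>0 \<epsilon>1 \<epsilon>2))"
  define C where "C = 2 * c * T / (min 1 \<rho>)\<^sup>2 + 12 * c\<^sup>2 * T + 2 * \<beta>\<^sup>2"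
  have main: "AFAC \<epsilon>0 \<epsilon>1 \<epsilon>2 \<gamma> f h y v \<and> norm v \<le> R \<and>
      real (evaluations (jet_oracle f h) (alg \<epsilon>0 \<epsilon>1 \<epsilon>2 \<gamma> y0))
        \<le> C * max (1 / (\<epsilon>0\<^sup>2 * \<epsilon>1\<^sup>2)) (1 / (\<epsilon>0 ^ 3 * \<epsilon>2 ^ 3))"
    if \<epsilon>: "\<epsilon>0 > 0" "\<epsilon>1 > 0" "\<epsilon>2 > 0" "\<epsilon>0 \<le> \<beta>" "\<epsilon>1 \<le> 1"
      and \<gamma>: "\<gamma>\<^sup>2 \<le> 1 / 16 * inverse (R ^ 3) * \<epsilon>0 * \<epsilon>2"
      and reg: "regular_problem \<beta> \<rho> K f h" and y0: "y0 \<in> near_feasible h \<beta>"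
      and Lf: "Lf = (SUP y\<in>near_feasible h \<beta>. norm (grad f y))"
      and res: "result (jet_oracle f h) (alg \<epsilon>0 \<epsilon>1 \<epsilon>2 \<gamma> y0) = (y, v)"
    for \<epsilon>0 \<epsilon>1 \<epsilon>2 \<gamma> and f :: "real^'n \<Rightarrow> real" and h :: "real^'n \<Rightarrow> real^'m" and y0 y v
  proof -
    define \<sigma> where "\<sigma> = 2 * R / \<epsilon>0"
    define L where "L = c / \<epsilon>0"
    have grad_le: "norm (grad f z) \<le> K" if "z \<in> near_feasible h \<beta>" for z
      using reg that by (auto simp: regular_problem_def bdd_lipschitz_fun_def)
    have Lf_ge: "norm (grad f z) \<le> Lf" if "z \<in> near_feasible h \<beta>" for z
      unfolding Lf using grad_le that by (intro cSUP_upper bdd_aboveI2) auto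
    \<comment> \<open>These signs come from the existence of \<open>y0\<close>, so the positivity of
      the constants is only available for a given instance.\<close>
    have K: "0 \<le> K" and "0 \<le> Lf"
      using grad_le[OF y0] Lf_ge[OF y0] norm_ge_zero order_trans by blast+
    then have R: "2 \<le> R" using assms by simp
    have m: "0 \<le> m" by (simp add: m_def)
    have B: "0 \<le> B" using K m assms by (simp add: B_def)
    have T: "0 \<le> T" using K R assms by (simp add: T_def)
    have c: "1 \<le> c" using K R B m assms by (simp add: c_def)
    have \<beta>\<epsilon>: "1 \<le> \<beta> / \<epsilon>0" using \<epsilon> by simp
    have KL: "K \<le> K * \<beta> / \<epsilon>0" using mult_left_mono[OF \<beta>\<epsilon> K] by simp
    have L_eq: "L = 1 / \<epsilon>0 + 5 * (K * \<beta> / \<epsilon>0 + \<sigma> * B) + 2 * m * K\<^sup>2 * (1 / \<epsilon>0 + \<sigma> * m)"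
      using \<epsilon> by (simp add: L_def c_def \<sigma>_def field_simps)
    interpret P: penalty f h \<beta> \<rho> K \<sigma>
    proof
      show "0 < \<sigma>" using R \<epsilon> by (simp add: \<sigma>_def)
    qed (use reg y0 assms in auto)
    have PB: "P.B = B" by (simp add: P.B_def B_def m_def)
    interpret penalty_method f h \<beta> \<rho> K \<sigma> Lf R \<epsilon>0 \<epsilon>1 \<epsilon>2 \<gamma> L "min \<epsilon>1 \<rho>"
    proof
      show "norm (grad f z) \<le> Lf" if "z \<in> near_feasible h \<beta>" for z using that by (rule Lf_ge)
      show "0 < L" using c \<epsilon> by (simp add: L_def)
      have "0 \<le> 2 * m * K\<^sup>2 * (1 / \<epsilon>0 + \<sigma> * m)" "0 < 1 / \<epsilon>0" using m P.\<sigma> \<epsilon> by simp_all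
      then show "5 * (K + \<sigma> * P.B) \<le> L" using KL unfolding PB L_eq by argo
      have "2 * m * K\<^sup>2 * (1 / \<beta> + \<sigma> * m) \<le> 2 * m * K\<^sup>2 * (1 / \<epsilon>0 + \<sigma> * m)"
        using m \<epsilon> by (intro mult_left_mono add_right_mono divide_left_mono mult_pos_pos) auto
      moreover have "0 \<le> 5 * (K * \<beta> / \<epsilon>0 + \<sigma> * B)" using K B P.\<sigma> assms \<epsilon> by simp
      moreover have "0 < 1 / \<epsilon>0" using \<epsilon> by simp
      ultimately show "2 * real CARD('m) * K\<^sup>2 * (1 / \<beta> + \<sigma> * real CARD('m)) < L"
        unfolding L_eq m_def by linarith
    qed (use \<epsilon> \<gamma> assms \<sigma>_def in auto)
    have D: "decrease = D \<epsilon>0 \<epsilon>1 \<epsilon>2" unfolding decrease_def by (simp only: D_def L_def)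
    have Dpos: "0 < decrease" using \<epsilon> assms(2) L(1) by (simp add: decrease_def)
    have kge: "T / \<epsilon>0 / decrease < real (k \<epsilon>0 \<epsilon>1 \<epsilon>2)"
      unfolding k_def D by linarith
    have kle: "real (k \<epsilon>0 \<epsilon>1 \<epsilon>2) \<le> T / \<epsilon>0 / decrease + 2"
      using T \<epsilon> Dpos unfolding k_def D by (simp add: of_nat_nat) linarith
    have "P.pen y0 + K \<le> 2 * K + \<sigma> * \<beta>\<^sup>2 / 2" using P.pen_bounds(2)[OF y0] by simp
    also have "\<dots> \<le> T / \<epsilon>0"
      using KL by (simp add: T_def \<sigma>_def add_divide_distrib)
    also have "\<dots> < real (k \<epsilon>0 \<epsilon>1 \<epsilon>2) * decrease"
      using kge unfolding pos_divide_less_eq[OF Dpos] .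
    finally have start: "P.pen y0 + K < real (k \<epsilon>0 \<epsilon>1 \<epsilon>2) * decrease" .
    have "real (evaluations (jet_oracle f h) (alg \<epsilon>0 \<epsilon>1 \<epsilon>2 \<gamma> y0)) \<le> real (k \<epsilon>0 \<epsilon>1 \<epsilon>2)"
      unfolding alg_def using evaluations_penalty_alg by simp
    also have "\<dots> \<le> T / \<epsilon>0 / decrease + 2" by (rule kle)
    also have "\<dots> \<le> C * max (1 / (\<epsilon>0\<^sup>2 * \<epsilon>1\<^sup>2)) (1 / (\<epsilon>0 ^ 3 * \<epsilon>2 ^ 3))"
      unfolding D D_def C_def using c T \<epsilon> assms(2) by (intro iteration_count_bound) auto
    finally show ?thesis
      using penalty_alg_correct[OF y0 start, of y v] res unfolding alg_def \<sigma>_def L_def by simp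
  qed
  show ?thesis
    unfolding Let_def case_prod_beta
    by (intro exI[of _ alg] exI[of _ C] allI impI, elim conjE, rule main)
      (assumption | simp only: prod.collapse)+
qed

end
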